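(* Let $G$ be a finite simple graph on $[n]$ whose edge ideal $I(G)\subset S=K[x_1,\dots,x_n]$ has a linear resolution. Then $\mathrm{HS}_1(I(G)^k)$ has linear quotients, and thus a linear resolution, for all integers $k\ge1$.
   Context: $K$ is a field and $S=K[x_1,\dots,x_n]$ is the standard graded polynomial ring. For a finite simple graph $G$ with vertex set $[n]=\{1,\dots,n\}$ and edge set $E(G)$, the edge ideal $I(G)\subset S$ is the ideal generated by the monomials $x_ix_j$ with $\{i,j\}\in E(G)$. For ${\bf a}=(a_1,\dots,a_n)\in\mathbb{Z}_{\ge0}^n$ put ${\bf x}^{\bf a}=x_1^{a_1}\cdots x_n^{a_n}$. The $i$th homological shift ideal of a monomial ideal $I\subset S$ is $\mathrm{HS}_i(I)=({\bf x}^{\bf a} : \mathrm{Tor}_i^S(K,I)_{\bf a}\ne0)$. A monomial ideal $I\subset S$ has linear quotients if there exists an order $u_1,\dots,u_m$ of its minimal monomial generating set $\mathcal{G}(I)$ such that the colon ideals $(u_1,\dots,u_{j-1}):u_j$ are generated by variables for all $j=2,\dots,m$. A graded ideal generated in a single degree $d$ has a linear resolution if $\mathrm{Tor}^S_i(K,I)_{i+j}=0$ for all $i$ and all $j\neq d$. The zero ideal is regarded as having linear quotients and a linear resolution. *)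

theory Defs
  imports Complex_Main "HOL-Library.Poly_Mapping"
begin

section \<open>The polynomial ring and its ideals\<close>

text \<open>
  The index set \<open>[n]\<close> is a finite linearly ordered type \<open>'n\<close>. Exponent vectors are elements of
  \<open>'n \<Rightarrow>\<^sub>0 nat\<close>, and \<open>S = K[x\<^sub>i : i \<in> 'n]\<close> is \<open>('n, 'k) pring\<close>, where \<open>lookup f a\<close> is the
  coefficient of \<open>x\<^sup>a\<close> in \<open>f\<close>. The order on \<open>'n\<close> is used only for the signs of the Koszul complex.
\<close>

type_synonym ('n, 'k) pring = "('n \<Rightarrow>\<^sub>0 nat) \<Rightarrow>\<^sub>0 'k"

definition monom :: "('n \<Rightarrow>\<^sub>0 nat) \<Rightarrow> ('n, 'k::field) pring"
  where "monom a = Poly_Mapping.single a 1"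

definition Var :: "'n \<Rightarrow> ('n, 'k::field) pring"
  where "Var i = monom (Poly_Mapping.single i 1)"

definition tdeg :: "('n::finite \<Rightarrow>\<^sub>0 nat) \<Rightarrow> nat"
  where "tdeg a = (\<Sum>i\<in>UNIV. Poly_Mapping.lookup a i)"

definition homogeneous :: "nat \<Rightarrow> ('n::finite, 'k::field) pring \<Rightarrow> bool"
  where "homogeneous d f \<longleftrightarrow> (\<forall>a\<in>Poly_Mapping.keys f. tdeg a = d)"

text \<open>The ideal generated by a set: the span in the ring regarded as a module over itself.\<close>

lemma module_times: "module ((*) :: 'a::comm_ring_1 \<Rightarrow> 'a \<Rightarrow> 'a)"
  by standard (auto simp: algebra_simps)

definition ideal_gen :: "'a::comm_ring_1 set \<Rightarrow> 'a set"
  where "ideal_gen = module.span (*)"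

definition ideal_mult :: "'a::comm_ring_1 set \<Rightarrow> 'a set \<Rightarrow> 'a set"
  where "ideal_mult I J = ideal_gen {f * g | f g. f \<in> I \<and> g \<in> J}"

primrec ideal_power :: "'a::comm_ring_1 set \<Rightarrow> nat \<Rightarrow> 'a set"
  where
    "ideal_power I 0 = UNIV"
  | "ideal_power I (Suc k) = ideal_mult I (ideal_power I k)"

definition colon :: "'a::comm_ring_1 set \<Rightarrow> 'a \<Rightarrow> 'a set"
  where "colon J u = {f. f * u \<in> J}"


section \<open>Graphs and edge ideals\<close>

definition simple_graph :: "'n set set \<Rightarrow> bool"
  where "simple_graph E \<longleftrightarrow> (\<forall>e\<in>E. card e = 2)"

definition edge_ideal :: "'n set set \<Rightarrow> ('n, 'k::field) pring set"
  where "edge_ideal E = ideal_gen {Var i * Var j | i j. {i, j} \<in> E}"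


section \<open>Multigraded free resolutions of \<open>K\<close> and Tor\<close>

text \<open>
  A complex \<open>\<dots> \<rightarrow> F\<^sub>1 \<rightarrow> F\<^sub>0 \<rightarrow> K\<close> of free \<open>S\<close>-modules of finite rank is given by a basis \<open>fbasis F i\<close> of
  every \<open>F\<^sub>i\<close>, the multidegrees of the basis elements, the matrices of the differentials
  (\<open>fmat F i b b'\<close> is the coefficient of \<open>b'\<close> in the image of \<open>b\<close> under \<open>F\<^sub>i\<^sub>+\<^sub>1 \<rightarrow> F\<^sub>i\<close>), and the values
  of the augmentation \<open>F\<^sub>0 \<rightarrow> K\<close> on the basis of \<open>F\<^sub>0\<close>.
\<close>

record (overloaded) ('n, 'k, 'b) free_complex =
  fbasis :: "nat \<Rightarrow> 'b set"
  fdeg :: "nat \<Rightarrow> 'b \<Rightarrow> ('n \<Rightarrow>\<^sub>0 nat)"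
  fmat :: "nat \<Rightarrow> 'b \<Rightarrow> 'b \<Rightarrow> (('n \<Rightarrow>\<^sub>0 nat) \<Rightarrow>\<^sub>0 'k)"
  faug :: "'b \<Rightarrow> 'k"

text \<open>
  \<open>F\<^sub>i \<otimes>\<^sub>S I\<close> is a direct sum of copies of \<open>I\<close> indexed by the basis of \<open>F\<^sub>i\<close>; its elements are functions
  from the basis to \<open>I\<close>, extended by \<open>0\<close>. For \<open>I = S\<close> this is \<open>F\<^sub>i\<close> itself.
\<close>

definition chains :: "('n, 'k::field, 'b) free_complex \<Rightarrow> ('n, 'k) pring set \<Rightarrow> nat
    \<Rightarrow> ('b \<Rightarrow> ('n, 'k) pring) set"
  where "chains F I i = {c. (\<forall>b\<in>fbasis F i. c b \<in> I) \<and> (\<forall>b. b \<notin> fbasis F i \<longrightarrow> c b = 0)}"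

text \<open>The differential \<open>F\<^sub>i\<^sub>+\<^sub>1 \<otimes> I \<rightarrow> F\<^sub>i \<otimes> I\<close>.\<close>

definition fdiff :: "('n, 'k::field, 'b) free_complex \<Rightarrow> nat
    \<Rightarrow> ('b \<Rightarrow> ('n, 'k) pring) \<Rightarrow> ('b \<Rightarrow> ('n, 'k) pring)"
  where "fdiff F i c = (\<lambda>b'. if b' \<in> fbasis F i
            then \<Sum>b\<in>fbasis F (Suc i). c b * fmat F i b b' else 0)"

primrec cycles :: "('n, 'k::field, 'b) free_complex \<Rightarrow> ('n, 'k) pring set \<Rightarrow> nat
    \<Rightarrow> ('b \<Rightarrow> ('n, 'k) pring) set"
  where
    "cycles F I 0 = chains F I 0"
  | "cycles F I (Suc i) = {c \<in> chains F I (Suc i). fdiff F i c = (\<lambda>_. 0)}"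

definition boundaries :: "('n, 'k::field, 'b) free_complex \<Rightarrow> ('n, 'k) pring set \<Rightarrow> nat
    \<Rightarrow> ('b \<Rightarrow> ('n, 'k) pring) set"
  where "boundaries F I i = fdiff F i ` chains F I (Suc i)"

text \<open>The \<open>S\<close>-linear map \<open>F\<^sub>0 \<rightarrow> K\<close>; a polynomial acts on \<open>K\<close> through its constant coefficient.\<close>

definition aug_map :: "('n, 'k::field, 'b) free_complex \<Rightarrow> ('b \<Rightarrow> ('n, 'k) pring) \<Rightarrow> 'k"
  where "aug_map F c = (\<Sum>b\<in>fbasis F 0. Poly_Mapping.lookup (c b) 0 * faug F b)"

definition graded_free_resolution_of_K :: "('n, 'k::field, 'b) free_complex \<Rightarrow> bool"
  where "graded_free_resolution_of_K F \<longleftrightarrow>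
    (\<forall>i. finite (fbasis F i)) \<and>
    (\<forall>i. \<forall>b\<in>fbasis F (Suc i). \<forall>b'\<in>fbasis F i. \<forall>a\<in>Poly_Mapping.keys (fmat F i b b').
        a + fdeg F i b' = fdeg F (Suc i) b) \<and>
    (\<forall>b\<in>fbasis F 0. faug F b \<noteq> 0 \<longrightarrow> fdeg F 0 b = 0) \<and>
    aug_map F ` chains F UNIV 0 = UNIV \<and>
    {c \<in> chains F UNIV 0. aug_map F c = 0} = boundaries F UNIV 0 \<and>
    (\<forall>i. cycles F UNIV (Suc i) = boundaries F UNIV (Suc i))"

text \<open>The multidegrees of the nonzero homogeneous components of an element of \<open>F\<^sub>i \<otimes> I\<close>.\<close>

definition chain_degrees :: "('n, 'k::field, 'b) free_complex \<Rightarrow> nat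
    \<Rightarrow> ('b \<Rightarrow> ('n, 'k) pring) \<Rightarrow> ('n \<Rightarrow>\<^sub>0 nat) set"
  where "chain_degrees F i c =
    {a + fdeg F i b | a b. b \<in> fbasis F i \<and> a \<in> Poly_Mapping.keys (c b)}"

text \<open>
  The part of \<open>H\<^sub>i(F \<otimes> I) = Z\<^sub>i / B\<^sub>i\<close> with multidegrees in \<open>D\<close> is nonzero iff some cycle with
  multidegrees in \<open>D\<close> is not a boundary.
\<close>

definition homology_nonzero :: "('n, 'k::field, 'b) free_complex \<Rightarrow> nat \<Rightarrow> ('n, 'k) pring set
    \<Rightarrow> ('n \<Rightarrow>\<^sub>0 nat) set \<Rightarrow> bool"
  where "homology_nonzero F i I D \<longleftrightarrow>
    (\<exists>c\<in>cycles F I i. chain_degrees F i c \<subseteq> D \<and> c \<notin> boundaries F I i)"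

text \<open>
  \<open>Tor\<^sub>i\<^sup>S(K, I)\<close> is the homology of \<open>F \<otimes>\<^sub>S I\<close> for a free resolution \<open>F\<close> of \<open>K\<close>. The resolution chosen
  here is the Koszul complex on the variables; \<open>koszul_resolution\<close> below proves that it is one.
  The basis element indexed by \<open>A = {j\<^sub>1 < \<dots> < j\<^sub>i}\<close> is \<open>e\<^sub>A = e\<^bsub>j\<^sub>1\<^esub> \<and> \<dots> \<and> e\<^bsub>j\<^sub>i\<^esub>\<close>, and
  \<open>\<partial> e\<^sub>A = \<Sum>j\<in>A. \<plusminus> x\<^sub>j e\<^bsub>A - {j}\<^esub>\<close>.
\<close>

definition ksign :: "'n::linorder \<Rightarrow> 'n set \<Rightarrow> 'k::field"
  where "ksign j A = (-1) ^ card {l \<in> A. l < j}"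

definition koszul :: "('n::{finite, linorder}, 'k::field, 'n set) free_complex"
  where "koszul =
    \<lparr> fbasis = (\<lambda>i. {A. card A = i}),
      fdeg = (\<lambda>i A. \<Sum>j\<in>A. Poly_Mapping.single j 1),
      fmat = (\<lambda>i A A'. \<Sum>j\<in>A. if A' = A - {j}
                then Poly_Mapping.single (Poly_Mapping.single j 1) (ksign j A) else 0),
      faug = (\<lambda>A. 1) \<rparr>"

definition Tor_multi_nonzero ::
    "nat \<Rightarrow> ('n::{finite, linorder}, 'k::field) pring set \<Rightarrow> ('n \<Rightarrow>\<^sub>0 nat) \<Rightarrow> bool"
  where "Tor_multi_nonzero i I a \<longleftrightarrow> homology_nonzero koszul i I {a}"

definition Tor_nonzero :: "nat \<Rightarrow> ('n::{finite, linorder}, 'k::field) pring set \<Rightarrow> nat \<Rightarrow> bool"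
  where "Tor_nonzero i I m \<longleftrightarrow> homology_nonzero koszul i I {a. tdeg a = m}"


subsection \<open>The Koszul complex resolves \<open>K\<close>\<close>

lemma lookup_times_single:
  fixes f :: "('n \<Rightarrow>\<^sub>0 nat) \<Rightarrow>\<^sub>0 'k::field"
  shows "Poly_Mapping.lookup (f * Poly_Mapping.single (Poly_Mapping.single j 1) c) m =
    (if Poly_Mapping.lookup m j > 0
     then Poly_Mapping.lookup f (m - Poly_Mapping.single j 1) * c else 0)"
proof -
  let ?t = "Poly_Mapping.single j (1::nat)"
  have inner: "(\<Sum>q. Poly_Mapping.lookup (Poly_Mapping.single ?t c) q when m = l + q) =
      (c when m = l + ?t)" for l :: "'n \<Rightarrow>\<^sub>0 nat"
  proof -
    have eq: "(\<lambda>q. Poly_Mapping.lookup (Poly_Mapping.single ?t c) q when m = l + q) =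
        (\<lambda>q. (c when m = l + ?t) when q = ?t)"
      by (auto simp: lookup_single when_def)
    show ?thesis unfolding eq by (rule Sum_any_when_equal)
  qed
  have *: "Poly_Mapping.lookup (f * Poly_Mapping.single ?t c) m =
      (\<Sum>l. Poly_Mapping.lookup f l * (c when m = l + ?t))"
    by (simp only: lookup_mult inner)
  show ?thesis
  proof (cases "Poly_Mapping.lookup m j > 0")
    case True
    have "m = l + ?t \<longleftrightarrow> l = m - ?t" for l
    proof
      assume "l = m - ?t"
      then show "m = l + ?t" using True
        by (intro poly_mapping_eqI) (auto simp: lookup_add lookup_minus lookup_single when_def)
    qed simp
    then have eq: "(\<lambda>l. Poly_Mapping.lookup f l * (c when m = l + ?t)) =
        (\<lambda>l. (Poly_Mapping.lookup f l * c) when l = m - ?t)"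
      by (auto simp: when_def)
    show ?thesis using True unfolding * eq Sum_any_when_equal by simp
  next
    case False
    then have "m \<noteq> l + ?t" for l
      by (metis add_gr_0 less_one lookup_add lookup_single_eq)
    then show ?thesis using False unfolding * by simp
  qed
qed

lemma lookup_koszul_diff:
  fixes c :: "'n::{finite, linorder} set \<Rightarrow> ('n, 'k::field) pring"
  assumes "card A' = i"
  shows "Poly_Mapping.lookup (fdiff koszul i c A') m =
    (\<Sum>j\<in>{j. j \<notin> A' \<and> Poly_Mapping.lookup m j > 0}.
       Poly_Mapping.lookup (c (insert j A')) (m - Poly_Mapping.single j 1) * ksign j (insert j A'))"
proof -
  let ?s = "\<lambda>A j. c A * Poly_Mapping.single (Poly_Mapping.single j 1) (ksign j A)"
  have fd: "fdiff koszul i c A' =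
      (\<Sum>A\<in>{A. card A = Suc i}. c A * (\<Sum>j\<in>A. if A' = A - {j}
         then Poly_Mapping.single (Poly_Mapping.single j 1) (ksign j A) else 0))"
    using assms by (simp add: fdiff_def koszul_def)
  also have "\<dots> = (\<Sum>A\<in>{A. card A = Suc i}. \<Sum>j\<in>{j\<in>A. A' = A - {j}}. ?s A j)"
    unfolding sum_distrib_left
    by (rule sum.cong[OF refl])
       (rule sum.mono_neutral_cong_right; simp split: if_splits)
  also have "\<dots> = (\<Sum>(A, j)\<in>(SIGMA A:{A. card A = Suc i}. {j\<in>A. A' = A - {j}}). ?s A j)"
    by (rule sum.Sigma) auto
  also have "\<dots> = (\<Sum>j\<in>- A'. ?s (insert j A') j)"
  proof -
    have "j \<in> A \<and> A' = A - {j} \<longleftrightarrow> j \<notin> A' \<and> A = insert j A'" for A j by auto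
    then have "(SIGMA A:{A. card A = Suc i}. {j\<in>A. A' = A - {j}}) =
        (\<lambda>j. (insert j A', j)) ` (- A')"
      using assms by auto
    moreover have "inj_on (\<lambda>j. (insert j A', j)) (- A')" by (auto intro: inj_onI)
    ultimately show ?thesis by (simp add: sum.reindex)
  qed
  finally show ?thesis
    by (simp only: lookup_sum lookup_times_single)
       (rule sum.mono_neutral_cong_right; auto)
qed

lemma ksign_insert:
  fixes A :: "'n::{finite, linorder} set"
  assumes "p < j" "p \<notin> A"
  shows "(ksign j (insert p A) :: 'k::field) = - ksign j A"
    and "(ksign p (insert j A) :: 'k::field) = ksign p A"
proof -
  have "{l \<in> insert p A. l < j} = insert p {l \<in> A. l < j}" using assms by auto
  then show "(ksign j (insert p A) :: 'k::field) = - ksign j A"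
    using assms by (simp add: ksign_def)
  have "{l \<in> insert j A. l < p} = {l \<in> A. l < p}" using assms by auto
  then show "(ksign p (insert j A) :: 'k::field) = ksign p A"
    by (simp add: ksign_def)
qed

lemma koszul_diff_diff:
  fixes c :: "'n::{finite, linorder} set \<Rightarrow> ('n, 'k::field) pring"
  shows "fdiff koszul i (fdiff koszul (Suc i) c) = (\<lambda>_. 0)"
proof
  fix A :: "'n set"
  show "fdiff koszul i (fdiff koszul (Suc i) c) A = 0"
  proof (cases "card A = i")
    case True
    show ?thesis
    proof (rule poly_mapping_eqI)
      fix m :: "'n \<Rightarrow>\<^sub>0 nat"
      let ?J = "{j. j \<notin> A \<and> Poly_Mapping.lookup m j > 0}"
      let ?P = "{(j, l). j \<in> ?J \<and> l \<in> ?J \<and> j \<noteq> l}"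
      let ?e = "\<lambda>j::'n. Poly_Mapping.single j (1::nat)"
      define g :: "'n \<Rightarrow> 'n \<Rightarrow> 'k" where "g j l =
        Poly_Mapping.lookup (c (insert l (insert j A))) (m - ?e j - ?e l)
          * ksign l (insert l (insert j A)) * ksign j (insert j A)" for j l
      have anti: "g j l = - g l j" if "j < l" "j \<in> ?J" "l \<in> ?J" for j l
      proof -
        have 1: "(ksign l (insert l (insert j A)) :: 'k) = - ksign l (insert l A)"
          using ksign_insert(1)[of j l "insert l A"] that by (auto simp: insert_commute)
        have 2: "(ksign j (insert j (insert l A)) :: 'k) = ksign j (insert j A)"
          using that by (auto simp: ksign_def intro!: arg_cong[of _ _ "\<lambda>x. (-1) ^ card x"])
        have 3: "m - ?e j - ?e l = m - ?e l - ?e j"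
          by (simp add: diff_diff_add add.commute)
        show ?thesis unfolding g_def insert_commute[of l j A] 2 3
          using 1 by (simp add: insert_commute mult_ac)
      qed
      have "Poly_Mapping.lookup (fdiff koszul i (fdiff koszul (Suc i) c) A) m =
          (\<Sum>j\<in>?J. \<Sum>l\<in>{l\<in>?J. l \<noteq> j}. g j l)"
        unfolding lookup_koszul_diff[OF True]
      proof (rule sum.cong[OF refl])
        fix j assume j: "j \<in> ?J"
        then have card: "card (insert j A) = Suc i" using True by simp
        have "{l. l \<notin> insert j A \<and> Poly_Mapping.lookup (m - ?e j) l > 0} = {l\<in>?J. l \<noteq> j}"
          by (auto simp: lookup_minus lookup_single)
        then show "Poly_Mapping.lookup (fdiff koszul (Suc i) c (insert j A)) (m - ?e j)
            * ksign j (insert j A) = (\<Sum>l\<in>{l\<in>?J. l \<noteq> j}. g j l)"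
          unfolding lookup_koszul_diff[OF card] sum_distrib_right
          by (intro sum.cong) (simp_all add: g_def)
      qed
      also have "\<dots> = (\<Sum>(j, l)\<in>(SIGMA j:?J. {l\<in>?J. l \<noteq> j}). g j l)"
        by (rule sum.Sigma) auto
      also have "(SIGMA j:?J. {l\<in>?J. l \<noteq> j}) =
          {(j, l). j \<in> ?J \<and> l \<in> ?J \<and> j < l} \<union> {(j, l). j \<in> ?J \<and> l \<in> ?J \<and> l < j}"
        by auto
      also have "(\<Sum>(j, l)\<in>\<dots>. g j l) =
          (\<Sum>(j, l)\<in>{(j, l). j \<in> ?J \<and> l \<in> ?J \<and> j < l}. g j l) +
          (\<Sum>(j, l)\<in>{(j, l). j \<in> ?J \<and> l \<in> ?J \<and> l < j}. g j l)"
        by (rule sum.union_disjoint) auto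
      also have "(\<Sum>(j, l)\<in>{(j, l). j \<in> ?J \<and> l \<in> ?J \<and> l < j}. g j l) =
          (\<Sum>(j, l)\<in>{(j, l). j \<in> ?J \<and> l \<in> ?J \<and> j < l}. - g j l)"
        by (rule sum.reindex_bij_witness[where i = prod.swap and j = prod.swap])
           (use anti in auto)
      also have "\<dots> = - (\<Sum>(j, l)\<in>{(j, l). j \<in> ?J \<and> l \<in> ?J \<and> j < l}. g j l)"
        by (simp add: case_prod_unfold sum_negf)
      finally show "Poly_Mapping.lookup (fdiff koszul i (fdiff koszul (Suc i) c) A) m =
          Poly_Mapping.lookup 0 m" by simp
    qed
  next
    case False
    then show ?thesis by (simp add: fdiff_def koszul_def)
  qed
qed

text \<open>
  A contracting homotopy in nonzero multidegrees: \<open>x\<^sup>a e\<^sub>A \<mapsto> x\<^bsup>a-p\<^esup> e\<^bsub>A \<union> {p}\<^esub>\<close>, where \<open>p\<close> is the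
  smallest variable dividing \<open>x\<^sup>a e\<^sub>A\<close>, and \<open>0\<close> if \<open>p \<in> A\<close>.
\<close>

definition khom :: "('n::{finite, linorder} set \<Rightarrow> ('n, 'k::field) pring)
    \<Rightarrow> 'n set \<Rightarrow> ('n, 'k) pring"
  where "khom c A = Abs_poly_mapping (\<lambda>m.
    let p = Min (A \<union> Poly_Mapping.keys m) in
    if p \<in> A then Poly_Mapping.lookup (c (A - {p})) (m + Poly_Mapping.single p 1) else 0)"

lemma lookup_khom:
  fixes c :: "'n::{finite, linorder} set \<Rightarrow> ('n, 'k::field) pring"
  shows "Poly_Mapping.lookup (khom c A) m =
    (let p = Min (A \<union> Poly_Mapping.keys m) in
     if p \<in> A then Poly_Mapping.lookup (c (A - {p})) (m + Poly_Mapping.single p 1) else 0)"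
proof -
  let ?f = "\<lambda>m. let p = Min (A \<union> Poly_Mapping.keys m) in
     if p \<in> A then Poly_Mapping.lookup (c (A - {p})) (m + Poly_Mapping.single p 1) else 0"
  have "{m. ?f m \<noteq> 0} \<subseteq>
      (\<Union>p\<in>A. (\<lambda>m. m - Poly_Mapping.single p 1) ` Poly_Mapping.keys (c (A - {p})))"
  proof
    fix m assume "m \<in> {m. ?f m \<noteq> 0}"
    then obtain p where p: "p \<in> A"
        "Poly_Mapping.lookup (c (A - {p})) (m + Poly_Mapping.single p 1) \<noteq> 0"
      by (auto simp: Let_def split: if_splits)
    then have "m + Poly_Mapping.single p 1 \<in> Poly_Mapping.keys (c (A - {p}))"
      by (simp add: in_keys_iff)
    moreover have "m = (m + Poly_Mapping.single p 1) - Poly_Mapping.single p 1" by simp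
    ultimately show "m \<in>
        (\<Union>p\<in>A. (\<lambda>m. m - Poly_Mapping.single p 1) ` Poly_Mapping.keys (c (A - {p})))"
      using p(1) by blast
  qed
  then have "finite {m. ?f m \<noteq> 0}"
    by (rule finite_subset) auto
  then show ?thesis unfolding khom_def by (rule fun_cong[OF lookup_Abs_poly_mapping])
qed

lemma koszul_homotopy:
  fixes c :: "'n::{finite, linorder} set \<Rightarrow> ('n, 'k::field) pring"
  assumes card: "card A = i"
    and nz: "A \<union> Poly_Mapping.keys m \<noteq> {}"
    and cyc: "i > 0 \<Longrightarrow> fdiff koszul (i - 1) c = (\<lambda>_. 0)"
  shows "Poly_Mapping.lookup (fdiff koszul i (khom c) A) m = Poly_Mapping.lookup (c A) m"
proof -
  let ?e = "\<lambda>j::'n. Poly_Mapping.single j (1::nat)"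
  let ?J = "{j. j \<notin> A \<and> Poly_Mapping.lookup m j > 0}"
  define p where "p = Min (A \<union> Poly_Mapping.keys m)"
  have p_in: "p \<in> A \<union> Poly_Mapping.keys m"
    unfolding p_def by (rule Min_in) (use nz in auto)
  have p_le: "p \<le> j" if "j \<in> A \<union> Poly_Mapping.keys m" for j
    unfolding p_def by (rule Min_le) (use that in auto)
  have supp: "insert j A \<union> Poly_Mapping.keys (m - ?e j) = A \<union> Poly_Mapping.keys m"
    if "j \<in> ?J" for j
    using that by (auto simp: in_keys_iff lookup_minus lookup_single when_def split: if_splits)
  have bk: "m - ?e j + ?e j = m" if "j \<in> ?J" for j
    using that by (intro poly_mapping_eqI) (auto simp: lookup_add lookup_minus lookup_single when_def)
  have hom: "Poly_Mapping.lookup (khom c (insert j A)) (m - ?e j) =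
      (if p \<in> insert j A
       then Poly_Mapping.lookup (c (insert j A - {p})) (m - ?e j + ?e p) else 0)"
    if "j \<in> ?J" for j
    unfolding lookup_khom supp[OF that] p_def[symmetric] Let_def ..
  have sign_p: "(ksign p B :: 'k) = 1" if "B \<subseteq> A \<union> Poly_Mapping.keys m" for B
  proof -
    have "{l \<in> B. l < p} = {}" using that p_le by (auto simp: not_less)
    then show ?thesis unfolding ksign_def by (simp only: card.empty power_0)
  qed
  have sum: "Poly_Mapping.lookup (fdiff koszul i (khom c) A) m =
      (\<Sum>j\<in>?J. (if p \<in> insert j A
         then Poly_Mapping.lookup (c (insert j A - {p})) (m - ?e j + ?e p) else 0)
         * ksign j (insert j A))"
    unfolding lookup_koszul_diff[OF card] by (intro sum.cong refl) (simp only: hom)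
  show ?thesis
  proof (cases "p \<in> A")
    case False
    then have pJ: "p \<in> ?J" using p_in by (auto simp: in_keys_iff)
    have "Poly_Mapping.lookup (fdiff koszul i (khom c) A) m =
        (\<Sum>j\<in>{p}. Poly_Mapping.lookup (c A) m)"
      unfolding sum
    proof (rule sum.mono_neutral_cong_right)
      fix j assume "j \<in> {p}"
      then have j: "j = p" by simp
      have "(ksign p (insert p A) :: 'k) = 1" by (rule sign_p) (use p_in in auto)
      moreover have "insert p A - {p} = A" using False by auto
      ultimately show "(if p \<in> insert j A
          then Poly_Mapping.lookup (c (insert j A - {p})) (m - ?e j + ?e p) else 0)
          * ksign j (insert j A) = Poly_Mapping.lookup (c A) m"
        unfolding j by (simp add: bk[OF pJ, simplified])
    qed (use False pJ in auto)
    then show ?thesis by simp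
  next
    case True
    define A0 where "A0 = A - {p}"
    define m0 where "m0 = m + ?e p"
    have ins: "insert p A0 = A" and pA0: "p \<notin> A0" using True by (auto simp: A0_def)
    have i: "i > 0" using True card by (metis card_gt_0_iff empty_iff finite)
    have card0: "card A0 = i - 1" using True card by (simp add: A0_def)
    have J0: "{j. j \<notin> A0 \<and> Poly_Mapping.lookup m0 j > 0} = insert p ?J"
      using True by (auto simp: A0_def m0_def lookup_add lookup_single when_def split: if_splits)
    have "0 = Poly_Mapping.lookup (fdiff koszul (i - 1) c A0) m0"
      using cyc[OF i] by simp
    also have "\<dots> = (\<Sum>j\<in>insert p ?J.
        Poly_Mapping.lookup (c (insert j A0)) (m0 - ?e j) * ksign j (insert j A0))"
      unfolding lookup_koszul_diff[OF card0] J0 ..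
    also have "\<dots> = Poly_Mapping.lookup (c A) m +
        (\<Sum>j\<in>?J. Poly_Mapping.lookup (c (insert j A0)) (m0 - ?e j) * ksign j (insert j A0))"
      using True sign_p[of A] by (subst sum.insert) (auto simp: ins m0_def)
    also have "(\<Sum>j\<in>?J. Poly_Mapping.lookup (c (insert j A0)) (m0 - ?e j)
          * ksign j (insert j A0)) =
        - Poly_Mapping.lookup (fdiff koszul i (khom c) A) m"
      unfolding sum sum_negf[symmetric]
    proof (rule sum.cong[OF refl])
      fix j assume j: "j \<in> ?J"
      then have ne: "j \<noteq> p" using True by auto
      then have lt: "p < j" using p_le[of j] j by (auto simp: in_keys_iff)
      have "insert p (insert j A0) = insert j A" using ins by auto
      then have sg: "(ksign j (insert j A) :: 'k) = - ksign j (insert j A0)"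
        using ksign_insert(1)[OF lt, of "insert j A0"] ne pA0 by simp
      have set: "insert j A - {p} = insert j A0" using ne by (auto simp: A0_def)
      have mm: "m0 - ?e j = m - ?e j + ?e p"
        using j ne by (intro poly_mapping_eqI)
          (auto simp: m0_def lookup_add lookup_minus lookup_single when_def)
      show "Poly_Mapping.lookup (c (insert j A0)) (m0 - ?e j) * ksign j (insert j A0) =
          - ((if p \<in> insert j A
         then Poly_Mapping.lookup (c (insert j A - {p})) (m - ?e j + ?e p) else 0)
         * ksign j (insert j A))"
        using True by (simp only: sg set mm if_True insert_iff simp_thms mult_minus_right minus_minus)
    qed
    finally show ?thesis by simp
  qed
qed

definition khom_chain :: "nat \<Rightarrow> ('n::{finite, linorder} set \<Rightarrow> ('n, 'k::field) pring)
    \<Rightarrow> 'n set \<Rightarrow> ('n, 'k) pring"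
  where "khom_chain i c A = (if card A = Suc i then khom c A else 0)"

lemma khom_chain:
  "khom_chain i c \<in> chains koszul UNIV (Suc i)"
  "fdiff koszul i (khom_chain i c) = fdiff koszul i (khom c)"
  by (auto simp: chains_def khom_chain_def koszul_def fdiff_def intro!: sum.cong)

theorem koszul_resolution:
  "graded_free_resolution_of_K (koszul :: ('n::{finite, linorder}, 'k::field, 'n set) free_complex)"
proof -
  let ?F = "koszul :: ('n, 'k, 'n set) free_complex"
  have basis: "fbasis ?F i = {A. card A = i}" for i by (simp add: koszul_def)
  have basis0: "fbasis ?F 0 = {{}}" by (auto simp: koszul_def)
  have aug: "aug_map ?F c = Poly_Mapping.lookup (c {}) 0" for c
    unfolding aug_map_def basis0 by (simp add: koszul_def)
  have hom: "a + fdeg ?F i A' = fdeg ?F (Suc i) A"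
    if "a \<in> Poly_Mapping.keys (fmat ?F i A A')" for i A A' a
  proof -
    have "a \<in> Poly_Mapping.keys (\<Sum>j\<in>A. if A' = A - {j}
        then Poly_Mapping.single (Poly_Mapping.single j 1) (ksign j A :: 'k) else 0)"
      using that by (simp add: koszul_def)
    then obtain j where j: "j \<in> A" "a \<in> Poly_Mapping.keys (if A' = A - {j}
        then Poly_Mapping.single (Poly_Mapping.single j 1) (ksign j A :: 'k) else 0)"
      by (auto simp: in_keys_iff lookup_sum dest: sum.not_neutral_contains_not_neutral)
    then have "A' = A - {j}" "a = Poly_Mapping.single j 1"
      by (auto split: if_splits)
    then show ?thesis
      using j(1) sum.remove[of A j "\<lambda>j. Poly_Mapping.single j (1::nat)"]
      by (simp add: koszul_def)
  qed
  have surj: "aug_map ?F ` chains ?F UNIV 0 = UNIV"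
  proof -
    have "x \<in> aug_map ?F ` chains ?F UNIV 0" for x
      by (rule image_eqI[where x = "\<lambda>A. if A = {} then Poly_Mapping.single 0 x else 0"])
         (auto simp: aug chains_def basis)
    then show ?thesis by auto
  qed
  have exact0: "{c \<in> chains ?F UNIV 0. aug_map ?F c = 0} = boundaries ?F UNIV 0"
  proof (intro equalityI subsetI)
    fix c assume "c \<in> {c \<in> chains ?F UNIV 0. aug_map ?F c = 0}"
    then have c: "c \<in> chains ?F UNIV 0" and c0: "Poly_Mapping.lookup (c {}) 0 = 0"
      by (simp_all add: aug)
    have "fdiff ?F 0 (khom c) A = c A" for A
    proof (cases "card A = 0")
      case True
      then have A: "A = {}" by simp
      show ?thesis
      proof (rule poly_mapping_eqI)
        fix m
        show "Poly_Mapping.lookup (fdiff ?F 0 (khom c) A) m = Poly_Mapping.lookup (c A) m"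
        proof (cases "m = 0")
          case True
          then show ?thesis using c0
            unfolding lookup_koszul_diff[OF \<open>card A = 0\<close>] by (simp add: A)
        next
          case False
          then show ?thesis by (intro koszul_homotopy) (auto simp: A)
        qed
      qed
    next
      case False
      then show ?thesis using c by (simp add: fdiff_def chains_def basis)
    qed
    then have "c = fdiff ?F 0 (khom_chain 0 c)" by (simp add: khom_chain(2) fun_eq_iff)
    then show "c \<in> boundaries ?F UNIV 0"
      unfolding boundaries_def using khom_chain(1) by blast
  next
    fix c assume "c \<in> boundaries ?F UNIV 0"
    then obtain d where d: "c = fdiff ?F 0 d" by (auto simp: boundaries_def)
    have "Poly_Mapping.lookup (c {}) 0 = 0"
      unfolding d by (subst lookup_koszul_diff) simp_all
    then show "c \<in> {c \<in> chains ?F UNIV 0. aug_map ?F c = 0}"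
      by (simp add: aug d chains_def fdiff_def)
  qed
  have exact: "cycles ?F UNIV (Suc i) = boundaries ?F UNIV (Suc i)" for i
  proof (intro equalityI subsetI)
    fix c assume "c \<in> cycles ?F UNIV (Suc i)"
    then have c: "c \<in> chains ?F UNIV (Suc i)" and c0: "fdiff ?F i c = (\<lambda>_. 0)"
      by simp_all
    have "fdiff ?F (Suc i) (khom c) A = c A" for A
    proof (cases "card A = Suc i")
      case True
      then show ?thesis using c0
        by (intro poly_mapping_eqI koszul_homotopy) auto
    next
      case False
      then show ?thesis using c by (simp add: fdiff_def chains_def basis)
    qed
    then have "c = fdiff ?F (Suc i) (khom_chain (Suc i) c)"
      by (simp add: khom_chain(2) fun_eq_iff)
    then show "c \<in> boundaries ?F UNIV (Suc i)"
      unfolding boundaries_def using khom_chain(1) by blast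
  next
    fix c assume "c \<in> boundaries ?F UNIV (Suc i)"
    then obtain d where d: "c = fdiff ?F (Suc i) d" by (auto simp: boundaries_def)
    then show "c \<in> cycles ?F UNIV (Suc i)"
      by (simp add: koszul_diff_diff) (simp add: chains_def fdiff_def)
  qed
  have "finite (fbasis ?F i)" for i by simp
  moreover have "fdeg ?F 0 b = 0" if "b \<in> fbasis ?F 0" for b
    using that by (simp add: basis0) (simp add: koszul_def)
  ultimately show ?thesis
    unfolding graded_free_resolution_of_K_def using hom surj exact0 exact by blast
qed


section \<open>Homological shift ideals, linear quotients, linear resolutions\<close>

definition HS :: "nat \<Rightarrow> ('n::{finite, linorder}, 'k::field) pring set \<Rightarrow> ('n, 'k) pring set"
  where "HS i I = ideal_gen {monom a | a. Tor_multi_nonzero i I a}"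

definition minimal_monomial_generating_set ::
    "('n, 'k::field) pring set \<Rightarrow> ('n, 'k) pring set \<Rightarrow> bool"
  where "minimal_monomial_generating_set I M \<longleftrightarrow>
    M \<subseteq> range monom \<and> ideal_gen M = I \<and> (\<forall>N. N \<subset> M \<longrightarrow> ideal_gen N \<noteq> I)"

text \<open>The zero ideal has linear quotients with respect to the empty list.\<close>

definition linear_quotients :: "('n, 'k::field) pring set \<Rightarrow> bool"
  where "linear_quotients I \<longleftrightarrow>
    (\<exists>us. distinct us \<and> minimal_monomial_generating_set I (set us) \<and>
      (\<forall>j. 1 \<le> j \<and> j < length us \<longrightarrow>
        (\<exists>V. colon (ideal_gen (set (take j us))) (us ! j) = ideal_gen (Var ` V))))"

text \<open>
  In \<open>Tor\<^sub>i(K, I)\<^bsub>i+j\<^esub> = 0\<close> for all \<open>j \<noteq> d\<close>, the internal degree \<open>i + j\<close> is written \<open>m\<close>; all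
  degrees occurring in the complex are natural numbers.
\<close>

definition linear_resolution :: "('n::{finite, linorder}, 'k::field) pring set \<Rightarrow> bool"
  where "linear_resolution I \<longleftrightarrow>
    I = {0} \<or>
    (\<exists>d. (\<exists>B. (\<forall>f\<in>B. homogeneous d f) \<and> I = ideal_gen B) \<and>
         (\<forall>i m. m \<noteq> i + d \<longrightarrow> \<not> Tor_nonzero i I m))"

end

theory Submission
  imports Defs "HOL-Library.Multiset_Order"
begin

text \<open>
  All ideals in sight are monomial, so the argument takes place among exponent vectors.

  The strand of multidegree \<open>a\<close> of the Koszul complex of a monomial ideal is the augmented chain
  complex of the upper Koszul simplicial complex \<open>{A. x\<^sup>a / x\<^sup>A \<in> I}\<close> (\<open>homology_nonzero_iff\<close>), so
  \<open>Tor\<close> is nonzero exactly in the multidegrees in which this simplicial complex fails to be acyclic.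

  The hypothesis first gives linear quotients of \<open>I(G)\<close> itself. Let \<open>H\<close> be the complement of \<open>G\<close>. If \<open>s\<close>, \<open>s'\<close> are neighbours of a vertex \<open>v\<close> in \<open>H\<close> joined through a connected set \<open>B\<close> of
  non-neighbours of \<open>v\<close>, then \<open>s\<close>, \<open>s'\<close> are adjacent in \<open>H\<close>: otherwise \<open>H\<close> has a cycle through \<open>v\<close>, \<open>s\<close>,
  \<open>B\<close>, \<open>s'\<close> in which the edge \<open>vs\<close> lies in no triangle, and this yields a class in \<open>Tor\<close> off the
  linear strand (\<open>not_acyclic_at_of_complement_cycle\<close>, the easy half of Froeberg's theorem). As in
  Dirac's theorem, every induced subgraph of \<open>H\<close> then has a simplicial vertex \<open>p\<close>
  (\<open>ex_covering_vertex\<close>); listing the edges of \<open>G\<close> at \<open>p\<close> first and recursing orders the generators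
  of \<open>I(G)\<close> with linear quotients (\<open>ex_lin_quot_edges\<close>).

  Two operations preserve linear quotients. The first is taking powers of an ideal generated by
  quadratic monomials \<open>g\<^sub>0, \<dots>, g\<^sub>r\<close>: write each generator of the power as a product of the \<open>g\<^sub>m\<close> in
  the least possible way with respect to the multiset order on the indices, and order the
  generators of the power by these least factorizations (\<open>lin_quot_power_exps\<close>). That this works is
  the exchange lemma \<open>exchange_leading_factor\<close>. The second is \<open>HS\<^sub>1\<close> of an ideal generated in one degree \<open>d\<close>
  (\<open>lin_quot_shift_exps\<close>): a monomial of degree \<open>d + 1\<close> lies in \<open>HS\<^sub>1\<close> iff at least two generators
  divide it, and one orders these monomials by the stage at which the second divisor appears.

  Finally linear quotients in one degree give a linear resolution (\<open>lin_quot_acyclic_at\<close>):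
  adding one generator changes the upper Koszul complex by a set of faces that is a cone, except
  in the multidegrees on the linear strand.
\<close>

section \<open>Exponent vectors and monomial ideals\<close>

abbreviation expo :: "('n \<Rightarrow>\<^sub>0 nat) \<Rightarrow> 'n \<Rightarrow> nat" ("_\<langle>_\<rangle>" [1000, 0] 1000)
  where "a\<langle>i\<rangle> \<equiv> Poly_Mapping.lookup a i"

definition var_exp :: "'n \<Rightarrow> ('n \<Rightarrow>\<^sub>0 nat)" ("\<epsilon>")
  where "\<epsilon> i = Poly_Mapping.single i 1"

text \<open>The exponent vector of the squarefree monomial \<open>x\<^sup>A\<close>.\<close>

definition set_exp :: "'n::finite set \<Rightarrow> ('n \<Rightarrow>\<^sub>0 nat)"
  where "set_exp A = (\<Sum>j\<in>A. \<epsilon> j)"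

text \<open>
  Divisibility of monomials. A symbol of its own is used because \<open>\<le>\<close> on this type is a linear
  (lexicographic) order.
\<close>

definition divides_exp :: "('n \<Rightarrow>\<^sub>0 nat) \<Rightarrow> ('n \<Rightarrow>\<^sub>0 nat) \<Rightarrow> bool" (infix "\<preceq>" 50)
  where "a \<preceq> b \<longleftrightarrow> (\<forall>i. a\<langle>i\<rangle> \<le> b\<langle>i\<rangle>)"

definition upset :: "('n \<Rightarrow>\<^sub>0 nat) set \<Rightarrow> ('n \<Rightarrow>\<^sub>0 nat) set"
  where "upset M = {a. \<exists>b\<in>M. b \<preceq> a}"

lemma expo_var_exp [simp]: "(\<epsilon> i)\<langle>j\<rangle> = (if i = j then 1 else 0)"
  by (simp add: var_exp_def lookup_single when_def)

lemma expo_set_exp [simp]: "(set_exp A)\<langle>i\<rangle> = (if i \<in> A then 1 else 0)"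
  by (simp add: set_exp_def lookup_sum)

lemma expo_add [simp]: "(a + b)\<langle>i\<rangle> = a\<langle>i\<rangle> + b\<langle>i\<rangle>"
  by (simp add: lookup_add)

lemma expo_minus [simp]: "(a - b)\<langle>i\<rangle> = a\<langle>i\<rangle> - b\<langle>i\<rangle>"
  by (simp add: lookup_minus)

lemma exp_eq_iff: "a = b \<longleftrightarrow> (\<forall>i. a\<langle>i\<rangle> = b\<langle>i\<rangle>)" for a b :: "'n \<Rightarrow>\<^sub>0 nat"
  by (metis poly_mapping_eqI)

lemma var_exp_inject [simp]: "\<epsilon> i = \<epsilon> j \<longleftrightarrow> i = j"
  by (metis expo_var_exp zero_neq_one)

lemma divides_refl [simp]: "a \<preceq> a"
  by (simp add: divides_exp_def)

lemma divides_add [simp]: "a \<preceq> a + b" "a \<preceq> b + a"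
  by (simp_all add: divides_exp_def)

lemma divides_trans: "a \<preceq> b \<Longrightarrow> b \<preceq> c \<Longrightarrow> a \<preceq> c"
  unfolding divides_exp_def by (meson order_trans)

lemma divides_diff_add: "b \<preceq> a \<Longrightarrow> a - b + b = a"
  by (simp add: exp_eq_iff divides_exp_def)

lemma divides_iff_ex_add: "b \<preceq> a \<longleftrightarrow> (\<exists>c. a = b + c)"
  by (metis divides_add(1) divides_diff_add add.commute)

lemma tdeg_add [simp]: "tdeg (a + b) = tdeg a + tdeg b"
  by (simp add: tdeg_def sum.distrib)

lemma tdeg_var_exp [simp]: "tdeg (\<epsilon> i) = 1"
  by (simp add: tdeg_def)

lemma tdeg_set_exp [simp]: "tdeg (set_exp A) = card A"
  by (simp add: tdeg_def sum.If_cases)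

lemma divides_same_tdeg:
  assumes "a \<preceq> b" "tdeg b \<le> tdeg a"
  shows "a = b"
proof -
  have "b - a + a = b" by (rule divides_diff_add[OF assms(1)])
  then have "tdeg (b - a) = 0" using assms(2) by (metis add_diff_cancel_right' diff_is_0_eq tdeg_add)
  then have "\<forall>i. (b - a)\<langle>i\<rangle> = 0" unfolding tdeg_def by (subst (asm) sum_eq_0_iff) auto
  then show ?thesis using assms(1) unfolding exp_eq_iff divides_exp_def
    by (auto intro: le_antisym)
qed

lemma upset_mono: "M \<subseteq> N \<Longrightarrow> upset M \<subseteq> upset N"
  by (auto simp: upset_def)

lemma upset_add: "a \<in> upset M \<Longrightarrow> a + b \<in> upset M" "a \<in> upset M \<Longrightarrow> b + a \<in> upset M"
  unfolding upset_def using divides_trans divides_add by blast+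

lemma upset_divides: "a \<in> upset M \<Longrightarrow> a \<preceq> b \<Longrightarrow> b \<in> upset M"
  unfolding upset_def using divides_trans by blast

lemma subset_upset: "M \<subseteq> upset M"
  unfolding upset_def using divides_refl by blast

text \<open>
  This is what reduces statements about monomial ideals to statements about exponent vectors: the
  polynomials supported in an up-closed set are closed under addition and multiplication, and
  conversely every term of such a polynomial is a multiple of a generator.
\<close>

lemma mem_ideal_gen_monom_iff:
  fixes f :: "('n, 'k::field) pring"
  shows "f \<in> ideal_gen (monom ` M) \<longleftrightarrow> Poly_Mapping.keys f \<subseteq> upset M"
proof
  let ?T = "{f :: ('n, 'k) pring. Poly_Mapping.keys f \<subseteq> upset M}"
  have "module.span (*) (monom ` M) \<subseteq> ?T"
  proof (rule module.span_minimal[OF module_times])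
    show "(monom ` M :: ('n, 'k) pring set) \<subseteq> ?T"
      using subset_upset[of M] by (auto simp: monom_def)
    show "module.subspace (*) ?T"
      unfolding module.subspace_def[OF module_times]
    proof (intro conjI ballI allI)
      fix f g :: "('n, 'k) pring"
      assume "f \<in> ?T" "g \<in> ?T"
      then show "f + g \<in> ?T" using keys_add[of f g] by blast
    next
      fix c f :: "('n, 'k) pring"
      assume "f \<in> ?T"
      then show "c * f \<in> ?T" using keys_mult[of c f] upset_add by fast
    qed simp
  qed
  then show "f \<in> ideal_gen (monom ` M) \<Longrightarrow> Poly_Mapping.keys f \<subseteq> upset M"
    by (auto simp: ideal_gen_def)
next
  assume sub: "Poly_Mapping.keys f \<subseteq> upset M"
  have f: "f = (\<Sum>a\<in>Poly_Mapping.keys f. Poly_Mapping.single a (Poly_Mapping.lookup f a))"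
    by (rule poly_mapping_eqI)
       (auto simp: lookup_sum lookup_single when_def in_keys_iff sum.delta)
  have "Poly_Mapping.single a (Poly_Mapping.lookup f a) \<in> ideal_gen (monom ` M)"
    if a: "a \<in> Poly_Mapping.keys f" for a
  proof -
    obtain b where b: "b \<in> M" "b \<preceq> a" using sub a by (auto simp: upset_def)
    have "Poly_Mapping.single a (Poly_Mapping.lookup f a) =
        Poly_Mapping.single (a - b) (Poly_Mapping.lookup f a) * monom b"
      by (simp add: monom_def mult_single divides_diff_add[OF b(2)])
    then show ?thesis unfolding ideal_gen_def
      using b(1) by (simp add: module.span_scale[OF module_times] module.span_base[OF module_times])
  qed
  then show "f \<in> ideal_gen (monom ` M)"
    by (subst f) (auto simp: ideal_gen_def intro: module.span_sum[OF module_times])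
qed

lemma monom_mem_ideal_gen_iff:
  "(monom a :: ('n, 'k::field) pring) \<in> ideal_gen (monom ` M) \<longleftrightarrow> a \<in> upset M"
  by (simp add: mem_ideal_gen_monom_iff) (simp add: monom_def)

lemma monom_inject [simp]: "(monom a :: ('n, 'k::field) pring) = monom b \<longleftrightarrow> a = b"
  by (metis keys_single monom_def singleton_inject zero_neq_one)

lemma monom_mult: "(monom a :: ('n, 'k::field) pring) * monom b = monom (a + b)"
  by (simp add: monom_def mult_single)

lemma Var_eq_monom: "(Var i :: ('n, 'k::field) pring) = monom (\<epsilon> i)"
  by (simp add: Var_def var_exp_def)

lemma ideal_gen_UNIV:
  "ideal_gen (monom ` {0} :: ('n, 'k::field) pring set) = UNIV"
proof -
  have "f \<in> ideal_gen (monom ` {0})" for f :: "('n, 'k) pring"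
    unfolding mem_ideal_gen_monom_iff by (auto simp: upset_def divides_exp_def)
  then show ?thesis by blast
qed

lemma ideal_mult_monom:
  "ideal_mult (ideal_gen (monom ` M)) (ideal_gen (monom ` N)) =
    (ideal_gen (monom ` {a + b | a b. a \<in> M \<and> b \<in> N}) :: ('n, 'k::field) pring set)"
  (is "?L = ?R")
proof
  have "f * g \<in> ?R" if "f \<in> ideal_gen (monom ` M)" "g \<in> ideal_gen (monom ` N)"
    for f g :: "('n, 'k) pring"
    unfolding mem_ideal_gen_monom_iff
  proof
    fix m assume "m \<in> Poly_Mapping.keys (f * g)"
    from subsetD[OF keys_mult this] obtain a b where m: "m = a + b" "a \<in> Poly_Mapping.keys f" "b \<in> Poly_Mapping.keys g"
      by blast
    have "a \<in> upset M" "b \<in> upset N" using that m(2,3) unfolding mem_ideal_gen_monom_iff by blast+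
    then obtain a' b' where "a' \<in> M" "a' \<preceq> a" "b' \<in> N" "b' \<preceq> b"
      unfolding upset_def by blast
    then show "m \<in> upset {a + b | a b. a \<in> M \<and> b \<in> N}"
      unfolding upset_def m(1) divides_exp_def by (auto intro!: exI add_mono)
  qed
  then have "{f * g | f g. f \<in> ideal_gen (monom ` M) \<and> g \<in> ideal_gen (monom ` N)} \<subseteq> ?R"
    by blast
  then show "?L \<subseteq> ?R" unfolding ideal_mult_def ideal_gen_def
    by (rule module.span_minimal[OF module_times _ module.subspace_span[OF module_times]])
  have "h \<in> {f * g | f g. f \<in> ideal_gen (monom ` M) \<and> g \<in> ideal_gen (monom ` N)}"
    if "h \<in> monom ` {a + b | a b. a \<in> M \<and> b \<in> N}" for h :: "('n, 'k) pring"
  proof -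
    from that obtain a b where h: "h = monom a * monom b" "a \<in> M" "b \<in> N"
      by (auto simp: monom_mult)
    then show ?thesis unfolding ideal_gen_def by (blast intro: module.span_base[OF module_times])
  qed
  then show "?R \<subseteq> ?L" unfolding ideal_mult_def ideal_gen_def
    by (intro module.span_mono[OF module_times] subsetI)
qed

section \<open>Multigraded Koszul homology\<close>

text \<open>
  The simplicial boundary, with the signs of the Koszul complex; a chain is a function on all
  subsets, and the empty set is a face of dimension \<open>-1\<close>, which gives reduced homology.
\<close>

definition bdry :: "('n::{finite, linorder} set \<Rightarrow> 'k::field) \<Rightarrow> 'n set \<Rightarrow> 'k"
  where "bdry \<gamma> A = (\<Sum>j\<in>- A. \<gamma> (insert j A) * ksign j (insert j A))"

definition chain_on :: "'n set set \<Rightarrow> nat \<Rightarrow> ('n set \<Rightarrow> 'k::field) \<Rightarrow> bool"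
  where "chain_on \<Delta> i \<gamma> \<longleftrightarrow> (\<forall>A. \<gamma> A \<noteq> 0 \<longrightarrow> A \<in> \<Delta> \<and> card A = i)"

text \<open>
  Faces are counted by cardinality, so \<open>i\<close> here is the homological degree in the Koszul complex,
  one more than the simplicial dimension. In degree \<open>0\<close> every chain is a
  cycle, as in the Koszul complex. Acyclicity can depend on the characteristic, hence the type argument.
\<close>

definition acyclic_at :: "'k::field itself \<Rightarrow> 'n::{finite, linorder} set set \<Rightarrow> nat \<Rightarrow> bool"
  where "acyclic_at _ \<Delta> i \<longleftrightarrow>
    (\<forall>\<gamma> :: 'n set \<Rightarrow> 'k. chain_on \<Delta> i \<gamma> \<and> bdry \<gamma> = (\<lambda>_. 0) \<longrightarrow>
      (\<exists>\<delta>. chain_on \<Delta> (Suc i) \<delta> \<and> bdry \<delta> = \<gamma>))"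

definition down_closed :: "'n set set \<Rightarrow> bool"
  where "down_closed \<Delta> \<longleftrightarrow> (\<forall>A\<in>\<Delta>. \<forall>B. B \<subseteq> A \<longrightarrow> B \<in> \<Delta>)"

lemma bdry_add: "bdry (\<lambda>A. \<gamma> A + \<delta> A) A = bdry \<gamma> A + bdry \<delta> A"
  by (simp add: bdry_def distrib_right sum.distrib)

lemma bdry_diff: "bdry (\<lambda>A. \<gamma> A - \<delta> A) A = bdry \<gamma> A - bdry \<delta> A"
  by (simp add: bdry_def left_diff_distrib sum_subtractf)

lemma bdry_zero [simp]: "bdry (\<lambda>_. 0) = (\<lambda>_. 0)"
  by (simp add: bdry_def fun_eq_iff)

lemma ksign_square [simp]: "(ksign j A :: 'k::field) * ksign j A = 1"
  by (simp add: ksign_def power_add[symmetric] mult_2[symmetric])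

lemma ksign_square_left [simp]: "(ksign j A :: 'k::field) * (ksign j A * x) = x"
  by (simp add: mult.assoc[symmetric])

lemma ksign_nonzero [simp]: "(ksign j A :: 'k::field) \<noteq> 0"
  by (simp add: ksign_def)

text \<open>Removing two elements in the two possible orders gives opposite signs; this is \<open>\<partial>\<partial> = 0\<close>.\<close>

lemma ksign_swap:
  fixes A :: "'n::{finite, linorder} set"
  assumes "j \<noteq> l" "j \<notin> A" "l \<notin> A"
  shows "(ksign l (insert l (insert j A)) * ksign j (insert j A) :: 'k::field) =
    - (ksign j (insert l (insert j A)) * ksign l (insert l A))"
proof -
  have self: "(ksign i (insert i B) :: 'k) = ksign i B" for i and B :: "'n set"
    unfolding ksign_def by (rule arg_cong[of _ _ "\<lambda>C. (-1) ^ card C"]) auto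
  have *: "(ksign l (insert l (insert j A)) * ksign j (insert j A) :: 'k) =
      - (ksign j (insert l (insert j A)) * ksign l (insert l A))"
    if lt: "j < l" and nin: "j \<notin> A" "l \<notin> A" for j l
  proof -
    have 1: "(ksign l (insert l (insert j A)) :: 'k) = - ksign l (insert l A)"
      using ksign_insert(1)[OF lt nin(1), where ?'k = 'k] by (simp add: self)
    have 2: "(ksign j (insert l (insert j A)) :: 'k) = ksign j (insert j A)"
      using ksign_insert(2)[OF lt nin(1), where ?'k = 'k] by (simp add: self insert_commute[of l j])
    show ?thesis unfolding 1 2 by simp
  qed
  show ?thesis
  proof (cases "j < l")
    case True
    then show ?thesis using * assms by blast
  next
    case False
    then have "l < j" using assms by auto
    then have "(ksign j (insert j (insert l A)) * ksign l (insert l A) :: 'k) =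
        - (ksign l (insert j (insert l A)) * ksign j (insert j A))"
      using * assms by blast
    then show ?thesis by (simp add: insert_commute)
  qed
qed

lemma bdry_bdry: "bdry (bdry \<gamma>) = (\<lambda>_. 0)"
proof
  fix A :: "'a set"
  let ?J = "- A"
  define g where "g j l = \<gamma> (insert l (insert j A)) * (ksign l (insert l (insert j A)) * ksign j (insert j A))" for j l
  have anti: "g j l = - g l j" if "j < l" "j \<in> ?J" "l \<in> ?J" for j l
    using ksign_swap[of j l A, where ?'k = 'b] that
    by (simp add: g_def insert_commute)
  have "bdry (bdry \<gamma>) A = (\<Sum>j\<in>?J. \<Sum>l\<in>{l\<in>?J. l \<noteq> j}. g j l)"
    unfolding bdry_def g_def
    by (intro sum.cong refl) (auto simp: sum_distrib_right mult.assoc intro!: sum.cong)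
  also have "\<dots> = (\<Sum>(j, l)\<in>(SIGMA j:?J. {l\<in>?J. l \<noteq> j}). g j l)"
    by (rule sum.Sigma) auto
  also have "(SIGMA j:?J. {l\<in>?J. l \<noteq> j}) =
      {(j, l). j \<in> ?J \<and> l \<in> ?J \<and> j < l} \<union> {(j, l). j \<in> ?J \<and> l \<in> ?J \<and> l < j}"
    by auto
  also have "(\<Sum>(j, l)\<in>\<dots>. g j l) =
      (\<Sum>(j, l)\<in>{(j, l). j \<in> ?J \<and> l \<in> ?J \<and> j < l}. g j l) +
      (\<Sum>(j, l)\<in>{(j, l). j \<in> ?J \<and> l \<in> ?J \<and> l < j}. g j l)"
    by (rule sum.union_disjoint) auto
  also have "(\<Sum>(j, l)\<in>{(j, l). j \<in> ?J \<and> l \<in> ?J \<and> l < j}. g j l) =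
      (\<Sum>(j, l)\<in>{(j, l). j \<in> ?J \<and> l \<in> ?J \<and> j < l}. - g j l)"
    by (rule sum.reindex_bij_witness[where i = prod.swap and j = prod.swap])
       (use anti in auto)
  also have "\<dots> = - (\<Sum>(j, l)\<in>{(j, l). j \<in> ?J \<and> l \<in> ?J \<and> j < l}. g j l)"
    by (simp add: case_prod_unfold sum_negf)
  finally show "bdry (bdry \<gamma>) A = 0" by simp
qed

lemma chain_on_mono: "chain_on \<Delta> i \<gamma> \<Longrightarrow> \<Delta> \<subseteq> \<Delta>' \<Longrightarrow> chain_on \<Delta>' i \<gamma>"
  by (auto simp: chain_on_def)

text \<open>
  The faces of \<open>\<Delta>'\<close> outside \<open>\<Delta>\<close> come in pairs \<open>A - {p}\<close>, \<open>A \<union> {p}\<close>, so the cone operator with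
  apex \<open>p\<close> contracts the relative complex: every cycle on \<open>\<Delta>'\<close> is moved into \<open>\<Delta>\<close> by a boundary.
  With \<open>\<Delta>\<close> empty this is the acyclicity of cones.
\<close>

lemma relative_cone:
  fixes \<Delta> \<Delta>' :: "'n::{finite, linorder} set set"
  assumes sub: "\<Delta> \<subseteq> \<Delta>'" and down: "down_closed \<Delta>" "down_closed \<Delta>'"
    and apex: "\<And>A. A \<in> \<Delta>' - \<Delta> \<Longrightarrow> insert p A \<in> \<Delta>' - \<Delta> \<and> A - {p} \<in> \<Delta>' - \<Delta>"
    and ac: "acyclic_at TYPE('k::field) \<Delta> i"
  shows "acyclic_at TYPE('k) \<Delta>' i"
  unfolding acyclic_at_def
proof (intro allI impI)
  fix \<gamma> :: "'n set \<Rightarrow> 'k"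
  assume "chain_on \<Delta>' i \<gamma> \<and> bdry \<gamma> = (\<lambda>_. 0)"
  then have \<gamma>: "\<And>A. \<gamma> A \<noteq> 0 \<Longrightarrow> A \<in> \<Delta>' \<and> card A = i" and cyc: "\<And>A. bdry \<gamma> A = 0"
    by (auto simp: chain_on_def)
  let ?R = "\<Delta>' - \<Delta>"
  \<comment> \<open>The cone operator; it is nonzero only on the faces of the relative complex.\<close>
  define g where "g A = (if p \<in> A \<and> A \<in> ?R then ksign p A * \<gamma> (A - {p}) else 0)" for A
  have g: "chain_on \<Delta>' (Suc i) g"
    using \<gamma> unfolding chain_on_def g_def
    by (auto split: if_splits) (metis DiffE card.remove finite)
  have R: "bdry g A = \<gamma> A" if A: "A \<in> ?R" for A
  proof (cases "p \<in> A")
    case False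
    then have "bdry g A = (\<Sum>j\<in>{p}. \<gamma> A)"
      unfolding bdry_def using apex[OF A]
      by (intro sum.mono_neutral_cong_right) (auto simp: g_def mult_ac insert_Diff_if)
    then show ?thesis by simp
  next
    case True
    define B where "B = A - {p}"
    have B: "A = insert p B" "p \<notin> B" "B \<in> ?R" using True apex[OF A] by (auto simp: B_def)
    have nz: "insert p (insert j B) \<in> ?R" if "\<gamma> (insert j B) \<noteq> 0" for j
    proof -
      have "insert j B \<in> \<Delta>'" using \<gamma>[OF that] by simp
      moreover have "insert j B \<notin> \<Delta>"
        using B(3) down(1) unfolding down_closed_def by blast
      ultimately show ?thesis using apex by blast
    qed
    have "0 = bdry \<gamma> B" by (simp add: cyc)
    also have "\<dots> = \<gamma> A * ksign p A + (\<Sum>j\<in>- A. \<gamma> (insert j B) * ksign j (insert j B))"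
    proof -
      have "- B = insert p (- A)" using B by auto
      then show ?thesis unfolding bdry_def by (simp add: B)
    qed
    also have "(\<Sum>j\<in>- A. \<gamma> (insert j B) * ksign j (insert j B)) =
        (\<Sum>j\<in>- A. - (ksign p A * (g (insert j A) * ksign j (insert j A))))"
    proof (rule sum.cong[OF refl])
      fix j assume j: "j \<in> - A"
      have "g (insert j A) = ksign p (insert j A) * \<gamma> (insert j B)"
        using nz[of j] j B by (auto simp: g_def insert_commute insert_Diff_if)
      moreover have "ksign j (insert j B) =
          - (ksign p A * (ksign p (insert j A) * ksign j (insert j A)) :: 'k)"
      proof -
        have "(ksign p (insert j A) * ksign j (insert j B) :: 'k) =
            - (ksign j (insert j A) * ksign p A)"
          using ksign_swap[of j p B, where ?'k = 'k] j B by (auto simp: insert_commute)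
        then have "ksign p (insert j A) * (ksign p (insert j A) * ksign j (insert j B) :: 'k) =
            ksign p (insert j A) * - (ksign j (insert j A) * ksign p A)"
          by (rule arg_cong)
        then show ?thesis by (simp add: mult_ac)
      qed
      ultimately show "\<gamma> (insert j B) * ksign j (insert j B) =
          - (ksign p A * (g (insert j A) * ksign j (insert j A)))"
        by simp
    qed
    also have "\<dots> = - (ksign p A * bdry g A)"
      by (simp add: bdry_def sum_distrib_left sum_negf)
    finally have "ksign p A * \<gamma> A = ksign p A * bdry g A" by (simp add: mult.commute)
    then show ?thesis by simp
  qed
  define \<gamma>' where "\<gamma>' A = \<gamma> A - bdry g A" for A
  have "chain_on \<Delta> i \<gamma>'"
    unfolding chain_on_def
  proof (intro allI impI)
    fix A assume nz: "\<gamma>' A \<noteq> 0"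
    have "A \<in> \<Delta>' \<and> card A = i"
    proof (cases "\<gamma> A = 0")
      case True
      then have "bdry g A \<noteq> 0" using nz by (simp add: \<gamma>'_def)
      then obtain j where "j \<notin> A" "g (insert j A) \<noteq> 0"
        unfolding bdry_def by (rule sum.not_neutral_contains_not_neutral) auto
      then have "insert j A \<in> \<Delta>'" "card (insert j A) = Suc i" "j \<notin> A"
        using g by (auto simp: chain_on_def)
      moreover from this have "A \<in> \<Delta>'" using down(2) unfolding down_closed_def by blast
      ultimately show ?thesis by simp
    qed (use \<gamma> in auto)
    moreover have "A \<notin> ?R" using R[of A] nz unfolding \<gamma>'_def by (metis right_minus_eq)
    ultimately show "A \<in> \<Delta> \<and> card A = i" by auto
  qed
  moreover have "bdry \<gamma>' = (\<lambda>_. 0)"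
    using cyc fun_cong[OF bdry_bdry[of g]] by (simp add: fun_eq_iff \<gamma>'_def[abs_def] bdry_diff)
  ultimately obtain \<delta> where \<delta>: "chain_on \<Delta> (Suc i) \<delta>" "bdry \<delta> = \<gamma>'"
    using ac unfolding acyclic_at_def by blast
  show "\<exists>\<delta>. chain_on \<Delta>' (Suc i) \<delta> \<and> bdry \<delta> = \<gamma>"
  proof (intro exI conjI)
    show "chain_on \<Delta>' (Suc i) (\<lambda>A. g A + \<delta> A)"
      using g chain_on_mono[OF \<delta>(1) sub] unfolding chain_on_def by (metis add.right_neutral add_0)
    show "bdry (\<lambda>A. g A + \<delta> A) = \<gamma>"
      using \<delta>(2) by (simp add: fun_eq_iff bdry_add \<gamma>'_def)
  qed
qed

text \<open>
  New faces of other cardinalities do no harm: they create no new \<open>i\<close>-cycles, and extra faces of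
  cardinality \<open>i + 1\<close> only create more boundaries.
\<close>

lemma acyclic_at_cong:
  assumes "\<And>A. card A = i \<Longrightarrow> A \<in> \<Delta> \<longleftrightarrow> A \<in> \<Delta>'" "\<Delta> \<subseteq> \<Delta>'"
    "acyclic_at TYPE('k::field) \<Delta> i"
  shows "acyclic_at TYPE('k) \<Delta>' i"
  unfolding acyclic_at_def
proof (intro allI impI)
  fix \<gamma> :: "'a set \<Rightarrow> 'k"
  assume "chain_on \<Delta>' i \<gamma> \<and> bdry \<gamma> = (\<lambda>_. 0)"
  then have "chain_on \<Delta> i \<gamma>" "bdry \<gamma> = (\<lambda>_. 0)"
    unfolding chain_on_def by (simp_all add: assms(1))
  then obtain \<delta> where "chain_on \<Delta> (Suc i) \<delta>" "bdry \<delta> = \<gamma>"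
    using assms(3) unfolding acyclic_at_def by blast
  then show "\<exists>\<delta>. chain_on \<Delta>' (Suc i) \<delta> \<and> bdry \<delta> = \<gamma>"
    using chain_on_mono[OF _ assms(2)] by blast
qed

lemma acyclic_at_empty: "acyclic_at TYPE('k::field) {} i"
  unfolding acyclic_at_def
  by (auto simp: chain_on_def fun_eq_iff intro!: exI[of _ "\<lambda>_. 0"])

text \<open>
  The upper Koszul simplicial complex in degree \<open>a\<close> of the monomial ideal whose monomials have the
  exponents \<open>U\<close>.
\<close>

definition koszul_simplices :: "('n::finite \<Rightarrow>\<^sub>0 nat) set \<Rightarrow> ('n \<Rightarrow>\<^sub>0 nat) \<Rightarrow> 'n set set"
  where "koszul_simplices U a = {A. set_exp A \<preceq> a \<and> a - set_exp A \<in> U}"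

text \<open>
  The coefficients of the part of multidegree \<open>a\<close> of a Koszul chain \<open>c\<close>: the basis element \<open>e\<^sub>A\<close>
  has multidegree \<open>set_exp A\<close>, so only the monomial \<open>x\<^bsup>a - A\<^esup>\<close> of its coefficient contributes.
\<close>

definition component :: "('n::finite \<Rightarrow>\<^sub>0 nat) \<Rightarrow> ('n set \<Rightarrow> ('n, 'k::field) pring) \<Rightarrow> 'n set \<Rightarrow> 'k"
  where "component a c A = (if set_exp A \<preceq> a then Poly_Mapping.lookup (c A) (a - set_exp A) else 0)"

lemma component_fdiff:
  fixes c :: "'n::{finite, linorder} set \<Rightarrow> ('n, 'k::field) pring"
  assumes "\<And>A. card A \<noteq> Suc i \<Longrightarrow> c A = 0"
  shows "component a (fdiff koszul i c) = bdry (component a c)"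
proof
  fix A :: "'n set"
  show "component a (fdiff koszul i c) A = bdry (component a c) A"
  proof (cases "card A = i")
    case False
    then have "component a (fdiff koszul i c) A = 0"
      by (simp add: component_def fdiff_def koszul_def)
    moreover have "component a c (insert j A) = 0" if "j \<notin> A" for j
      using False that by (simp add: component_def assms)
    ultimately show ?thesis by (simp add: bdry_def)
  next
    case True
    show ?thesis
    proof (cases "set_exp A \<preceq> a")
      case le: True
      have *: "set_exp (insert j A) \<preceq> a \<longleftrightarrow> (a - set_exp A)\<langle>j\<rangle> > 0"
        "a - set_exp A - Poly_Mapping.single j 1 = a - set_exp (insert j A)" if "j \<notin> A" for j
      proof -
        show "set_exp (insert j A) \<preceq> a \<longleftrightarrow> (a - set_exp A)\<langle>j\<rangle> > 0"
        proof
          assume "set_exp (insert j A) \<preceq> a"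
          then have "1 \<le> a\<langle>j\<rangle>" unfolding divides_exp_def by (metis expo_set_exp insertI1)
          then show "(a - set_exp A)\<langle>j\<rangle> > 0" using that by simp
        next
          assume "(a - set_exp A)\<langle>j\<rangle> > 0"
          then have "1 \<le> a\<langle>j\<rangle>" using that by simp
          then show "set_exp (insert j A) \<preceq> a"
            using le unfolding divides_exp_def by (metis expo_set_exp insert_iff)
        qed
        show "a - set_exp A - Poly_Mapping.single j 1 = a - set_exp (insert j A)"
          using that by (auto simp: exp_eq_iff lookup_single when_def lookup_minus)
      qed
      have "component a (fdiff koszul i c) A = (\<Sum>j\<in>{j. j \<notin> A \<and> (a - set_exp A)\<langle>j\<rangle> > 0}.
         Poly_Mapping.lookup (c (insert j A)) (a - set_exp A - Poly_Mapping.single j 1)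
           * ksign j (insert j A))"
        using le by (simp only: component_def lookup_koszul_diff[OF True] if_True)
      also have "\<dots> = bdry (component a c) A"
        unfolding bdry_def
        by (rule sum.mono_neutral_cong_left) (auto simp: component_def *[unfolded One_nat_def])
      finally show ?thesis .
    next
      case nle: False
      have "set_exp A \<preceq> set_exp (insert j A)" for j unfolding divides_exp_def by auto
      then have "\<not> set_exp (insert j A) \<preceq> a" for j
        using nle divides_trans[of "set_exp A" "set_exp (insert j A)" a] by auto
      then show ?thesis using nle by (simp add: component_def bdry_def)
    qed
  qed
qed

lemma component_eqI:
  assumes "\<And>a. component a c = component a c'"
  shows "c = c'"
proof (rule ext, rule poly_mapping_eqI)
  fix A m
  have *: "component (m + set_exp A) d A = Poly_Mapping.lookup (d A) m" for d :: "'a set \<Rightarrow> ('a, 'b) pring"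
    by (simp add: component_def)
  show "Poly_Mapping.lookup (c A) m = Poly_Mapping.lookup (c' A) m"
    using assms[of "m + set_exp A"] by (metis *)
qed

lemma chain_on_component:
  fixes c :: "'n::{finite, linorder} set \<Rightarrow> ('n, 'k::field) pring"
  assumes I: "\<And>f :: ('n, 'k) pring. f \<in> I \<longleftrightarrow> Poly_Mapping.keys f \<subseteq> U"
    and c: "c \<in> chains koszul I i"
  shows "chain_on (koszul_simplices U a) i (component a c)"
proof -
  have *: "c A \<in> I \<and> card A = i" if "c A \<noteq> 0" for A
    using c that by (auto simp: chains_def koszul_def)
  have "A \<in> koszul_simplices U a \<and> card A = i" if "component a c A \<noteq> 0" for A
  proof -
    from that have le: "set_exp A \<preceq> a" and nz: "Poly_Mapping.lookup (c A) (a - set_exp A) \<noteq> 0"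
      by (simp_all add: component_def split: if_splits)
    from nz have "c A \<noteq> 0" by auto
    with * have "Poly_Mapping.keys (c A) \<subseteq> U" "card A = i" using I[of "c A"] by blast+
    then show ?thesis using le nz by (auto simp: koszul_simplices_def in_keys_iff)
  qed
  then show ?thesis by (simp add: chain_on_def)
qed

text \<open>A Koszul chain is an arbitrary finite family of simplicial chains, one in each multidegree.\<close>

lemma ex_chain_with_components:
  fixes \<gamma> :: "('n::{finite, linorder} \<Rightarrow>\<^sub>0 nat) \<Rightarrow> 'n set \<Rightarrow> 'k::field"
  assumes I: "\<And>f :: ('n, 'k) pring. f \<in> I \<longleftrightarrow> Poly_Mapping.keys f \<subseteq> U"
    and ch: "\<And>a. chain_on (koszul_simplices U a) i (\<gamma> a)"
    and fin: "finite {a. \<gamma> a \<noteq> (\<lambda>_. 0)}"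
  obtains c where "c \<in> chains koszul I i" "\<And>a. component a c = \<gamma> a"
proof -
  define c where "c A = Abs_poly_mapping (\<lambda>m. \<gamma> (m + set_exp A) A)" for A
  have look: "Poly_Mapping.lookup (c A) m = \<gamma> (m + set_exp A) A" for A m
  proof -
    have "{m. \<gamma> (m + set_exp A) A \<noteq> 0} \<subseteq> (\<lambda>a. a - set_exp A) ` {a. \<gamma> a \<noteq> (\<lambda>_. 0)}"
    proof
      fix m assume "m \<in> {m. \<gamma> (m + set_exp A) A \<noteq> 0}"
      then have "\<gamma> (m + set_exp A) \<noteq> (\<lambda>_. 0)" by auto
      then show "m \<in> (\<lambda>a. a - set_exp A) ` {a. \<gamma> a \<noteq> (\<lambda>_. 0)}"
        by (intro image_eqI[of _ _ "m + set_exp A"]) simp_all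
    qed
    then have "finite {m. \<gamma> (m + set_exp A) A \<noteq> 0}"
      using fin finite_surj by blast
    then show ?thesis unfolding c_def by (rule fun_cong[OF lookup_Abs_poly_mapping])
  qed
  have zero: "\<gamma> (m + set_exp A) A = 0" if "card A \<noteq> i" for m A
    using ch that unfolding chain_on_def by blast
  have "c A \<in> I" for A
    unfolding I
  proof
    fix m assume "m \<in> Poly_Mapping.keys (c A)"
    then have "\<gamma> (m + set_exp A) A \<noteq> 0" by (simp add: in_keys_iff look)
    then have "A \<in> koszul_simplices U (m + set_exp A)" using ch unfolding chain_on_def by blast
    then show "m \<in> U" by (simp add: koszul_simplices_def)
  qed
  moreover have "c A = 0" if "card A \<noteq> i" for A
    using zero[OF that] by (intro poly_mapping_eqI) (simp add: look)
  ultimately have "c \<in> chains koszul I i"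
    by (simp add: chains_def koszul_def)
  moreover have "component a c = \<gamma> a" for a
  proof
    fix A
    show "component a c A = \<gamma> a A"
    proof (cases "set_exp A \<preceq> a")
      case True
      then show ?thesis by (simp add: component_def look divides_diff_add)
    next
      case False
      then have "\<gamma> a A = 0" using ch[of a] by (auto simp: chain_on_def koszul_simplices_def)
      then show ?thesis using False by (simp add: component_def)
    qed
  qed
  ultimately show ?thesis by (rule that)
qed

text \<open>
  By the previous lemmas the Koszul complex of a monomial ideal is the direct sum of the chain
  complexes of its upper Koszul simplicial complexes. A cycle bounds iff each of its finitely many
  nonzero components bounds.
\<close>

lemma homology_nonzero_iff:
  fixes I :: "('n::{finite, linorder}, 'k::field) pring set"
  assumes I: "\<And>f. f \<in> I \<longleftrightarrow> Poly_Mapping.keys f \<subseteq> U"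
  shows "homology_nonzero koszul i I D \<longleftrightarrow> (\<exists>a\<in>D. \<not> acyclic_at TYPE('k) (koszul_simplices U a) i)"
proof
  assume "homology_nonzero koszul i I D"
  then obtain c where c: "c \<in> cycles koszul I i" "chain_degrees koszul i c \<subseteq> D"
      "c \<notin> boundaries koszul I i"
    by (auto simp: homology_nonzero_def)
  have cc: "c \<in> chains koszul I i" using c(1) by (cases i) auto
  have card: "card A = i" if "c A \<noteq> 0" for A
    using cc that by (auto simp: chains_def koszul_def)
  have fdeg: "fdeg (koszul :: ('n, 'k, 'n set) free_complex) i A = set_exp A" for A
    by (simp add: koszul_def set_exp_def var_exp_def)
  have cyc: "bdry (component a c) = (\<lambda>_. 0)" for a
  proof (cases i)
    case 0
    then have "component a c (insert j A) = 0" for j A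
      using card[of "insert j A"] by (cases "c (insert j A) = 0") (auto simp: component_def)
    then show ?thesis by (simp add: bdry_def fun_eq_iff)
  next
    case (Suc n)
    then have "bdry (component a c) = component a (fdiff koszul n c)"
      using card by (intro component_fdiff[symmetric]) auto
    then show ?thesis using c(1) Suc by (simp add: component_def fun_eq_iff)
  qed
  have degD: "a \<in> D" if "component a c A \<noteq> 0" for a A
  proof -
    have *: "set_exp A \<preceq> a" "Poly_Mapping.lookup (c A) (a - set_exp A) \<noteq> 0"
      using that by (auto simp: component_def split: if_splits)
    then have "card A = i" using card[of A] by force
    then have "(a - set_exp A) + fdeg (koszul :: ('n, 'k, 'n set) free_complex) i A \<in> chain_degrees koszul i c"
      unfolding chain_degrees_def using *(2) by (auto simp: in_keys_iff koszul_def)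
    then show ?thesis using c(2) *(1) by (auto simp: fdeg divides_diff_add)
  qed
  show "\<exists>a\<in>D. \<not> acyclic_at TYPE('k) (koszul_simplices U a) i"
  proof (rule ccontr)
    assume "\<not> ?thesis"
    then have ac: "acyclic_at TYPE('k) (koszul_simplices U a) i" if "a \<in> D" for a using that by blast
    have "\<exists>\<delta>. chain_on (koszul_simplices U a) (Suc i) \<delta> \<and> bdry \<delta> = component a c \<and>
        (component a c = (\<lambda>_. 0) \<longrightarrow> \<delta> = (\<lambda>_. 0))" for a
    proof (cases "component a c = (\<lambda>_. 0)")
      case True
      then show ?thesis by (auto simp: chain_on_def)
    next
      case False
      then have "a \<in> D" using degD by (auto simp: fun_eq_iff)
      from ac[OF this] show ?thesis
        using chain_on_component[OF I cc] cyc False unfolding acyclic_at_def by blast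
    qed
    then have "\<forall>a. \<exists>\<delta>. chain_on (koszul_simplices U a) (Suc i) \<delta> \<and> bdry \<delta> = component a c \<and>
        (component a c = (\<lambda>_. 0) \<longrightarrow> \<delta> = (\<lambda>_. 0))" ..
    from choice[OF this] obtain \<delta> where
      "\<forall>a. chain_on (koszul_simplices U a) (Suc i) (\<delta> a) \<and> bdry (\<delta> a) = component a c \<and>
        (component a c = (\<lambda>_. 0) \<longrightarrow> \<delta> a = (\<lambda>_. 0))" ..
    then have \<delta>: "\<And>a. chain_on (koszul_simplices U a) (Suc i) (\<delta> a)"
        "\<And>a. bdry (\<delta> a) = component a c" "\<And>a. component a c = (\<lambda>_. 0) \<Longrightarrow> \<delta> a = (\<lambda>_. 0)"
      by simp_all
    have "{a. component a c \<noteq> (\<lambda>_. 0)} \<subseteq> (\<Union>A. (\<lambda>m. m + set_exp A) ` Poly_Mapping.keys (c A))"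
    proof
      fix a assume "a \<in> {a. component a c \<noteq> (\<lambda>_. 0)}"
      then obtain A where "component a c A \<noteq> 0" by (auto simp: fun_eq_iff)
      then have *: "set_exp A \<preceq> a" "a - set_exp A \<in> Poly_Mapping.keys (c A)"
        by (auto simp: component_def in_keys_iff split: if_splits)
      then show "a \<in> (\<Union>A. (\<lambda>m. m + set_exp A) ` Poly_Mapping.keys (c A))"
        by (intro UN_I[of A] image_eqI[of _ _ "a - set_exp A"]) (simp_all add: divides_diff_add)
    qed
    then have "finite {a. component a c \<noteq> (\<lambda>_. 0)}" by (rule finite_subset) auto
    then have "finite {a. \<delta> a \<noteq> (\<lambda>_. 0)}" by (rule rev_finite_subset) (use \<delta>(3) in auto)
    then obtain d where d: "d \<in> chains koszul I (Suc i)" "\<And>a. component a d = \<delta> a"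
      using ex_chain_with_components[OF I \<delta>(1)] by blast
    have "fdiff koszul i d = c"
    proof (rule component_eqI)
      fix a
      have "component a (fdiff koszul i d) = bdry (component a d)"
        using d(1) by (intro component_fdiff) (auto simp: chains_def koszul_def)
      then show "component a (fdiff koszul i d) = component a c" by (simp add: d(2) \<delta>(2))
    qed
    then show False using c(3) d(1) by (auto simp: boundaries_def)
  qed
next
  assume "\<exists>a\<in>D. \<not> acyclic_at TYPE('k) (koszul_simplices U a) i"
  then obtain a and \<gamma> :: "'n set \<Rightarrow> 'k" where a: "a \<in> D"
    and \<gamma>: "chain_on (koszul_simplices U a) i \<gamma>" "bdry \<gamma> = (\<lambda>_. 0)"
    and nb: "\<And>\<delta>. chain_on (koszul_simplices U a) (Suc i) \<delta> \<Longrightarrow> bdry \<delta> \<noteq> \<gamma>"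
    unfolding acyclic_at_def by blast
  \<comment> \<open>Conversely, a nonbounding cycle of degree \<open>a\<close> is concentrated in that degree.\<close>
  let ?\<gamma> = "\<lambda>b. if b = a then \<gamma> else (\<lambda>_. 0)"
  have "chain_on (koszul_simplices U b) i (?\<gamma> b)" for b
    using \<gamma>(1) by (auto simp: chain_on_def)
  moreover have "finite {b. ?\<gamma> b \<noteq> (\<lambda>_. 0)}"
    by (rule finite_subset[of _ "{a}"]) auto
  ultimately obtain c where c: "c \<in> chains koszul I i" "\<And>b. component b c = ?\<gamma> b"
    using ex_chain_with_components[OF I, of i ?\<gamma>] by blast
  have "c \<in> cycles koszul I i"
  proof (cases i)
    case (Suc n)
    have "fdiff koszul n c = (\<lambda>_. 0)"
    proof (rule component_eqI)
      fix b
      have "component b (fdiff koszul n c) = bdry (component b c)"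
        using c(1) Suc by (intro component_fdiff) (auto simp: chains_def koszul_def)
      then show "component b (fdiff koszul n c) = component b (\<lambda>_. 0)"
        using \<gamma>(2) by (simp add: c(2) component_def fun_eq_iff)
    qed
    then show ?thesis using c(1) Suc by simp
  qed (use c in simp)
  moreover have "chain_degrees koszul i c \<subseteq> D"
  proof
    fix b assume "b \<in> chain_degrees koszul i c"
    then obtain A m where b: "b = m + set_exp A" "m \<in> Poly_Mapping.keys (c A)"
      by (auto simp: chain_degrees_def koszul_def set_exp_def var_exp_def)
    then have "component b c A \<noteq> 0" by (simp add: component_def in_keys_iff)
    then show "b \<in> D" using a by (auto simp: c(2) split: if_splits)
  qed
  moreover have "c \<notin> boundaries koszul I i"
  proof
    assume "c \<in> boundaries koszul I i"
    then obtain d where d: "d \<in> chains koszul I (Suc i)" "c = fdiff koszul i d"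
      by (auto simp: boundaries_def)
    have "bdry (component a d) = component a c"
      unfolding d(2) using d(1) by (intro component_fdiff[symmetric]) (auto simp: chains_def koszul_def)
    then show False using nb[OF chain_on_component[OF I d(1)]] by (simp add: c(2))
  qed
  ultimately show "homology_nonzero koszul i I D" by (auto simp: homology_nonzero_def)
qed

section \<open>Linear quotients of exponent vectors\<close>

text \<open>
  The combinatorial form of the statement that the colon ideal \<open>(S) : x\<^sup>u\<close> is generated by variables:
  for every generator \<open>v\<close> some variable \<open>x\<^sub>q\<close> dividing \<open>x\<^sup>v : x\<^sup>u\<close> satisfies \<open>x\<^sub>q x\<^sup>u \<in> (S)\<close>. For
  monomials of one degree, the latter means \<open>x\<^sub>q x\<^sup>u = x\<^sub>c x\<^sup>w\<close> with \<open>w\<close> in \<open>S\<close>.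
\<close>

definition linear_step :: "('n \<Rightarrow>\<^sub>0 nat) set \<Rightarrow> ('n \<Rightarrow>\<^sub>0 nat) \<Rightarrow> bool"
  where "linear_step S u \<longleftrightarrow>
    (\<forall>v\<in>S. \<exists>w\<in>S. \<exists>q c. w + \<epsilon> c = u + \<epsilon> q \<and> u\<langle>q\<rangle> < v\<langle>q\<rangle>)"

definition lin_quot :: "('n \<Rightarrow>\<^sub>0 nat) list \<Rightarrow> bool"
  where "lin_quot us \<longleftrightarrow> distinct us \<and> (\<forall>j<length us. linear_step (set (take j us)) (us ! j))"

lemma lin_quot_Nil [simp]: "lin_quot []"
  by (simp add: lin_quot_def)

lemma lin_quot_snoc: "lin_quot (us @ [u]) \<longleftrightarrow> lin_quot us \<and> u \<notin> set us \<and> linear_step (set us) u"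
proof -
  have "(\<forall>j<length (us @ [u]). linear_step (set (take j (us @ [u]))) ((us @ [u]) ! j)) \<longleftrightarrow>
      (\<forall>j<length us. linear_step (set (take j us)) (us ! j)) \<and> linear_step (set us) u"
    by (auto simp: less_Suc_eq nth_append)
  then show ?thesis by (auto simp: lin_quot_def)
qed

lemma linear_step_Un: "linear_step S u \<Longrightarrow> linear_step T u \<Longrightarrow> linear_step (S \<union> T) u"
  unfolding linear_step_def by blast

text \<open>
  The conditions for the members of \<open>S\<close> are independent of each other, so two lists with linear
  quotients can be concatenated as soon as the first one handles itself against the second.
\<close>

lemma lin_quot_append:
  assumes "lin_quot xs" "lin_quot ys" "set xs \<inter> set ys = {}"
    and "\<And>u. u \<in> set ys \<Longrightarrow> linear_step (set xs) u"
  shows "lin_quot (xs @ ys)"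
  using assms(2-4)
proof (induction ys rule: rev_induct)
  case Nil
  then show ?case using assms(1) by simp
next
  case (snoc u ys)
  then have "lin_quot (xs @ ys)" by (simp add: lin_quot_snoc)
  moreover have "linear_step (set (xs @ ys)) u"
    using snoc by (simp add: lin_quot_snoc linear_step_Un)
  ultimately show ?case
    using snoc.prems lin_quot_snoc[of "xs @ ys" u] lin_quot_snoc[of ys u] by auto
qed

lemma linear_step_var_multiples:
  assumes "S \<subseteq> range (\<lambda>a. u + \<epsilon> a)" "w = u + \<epsilon> b" "w \<notin> S"
  shows "linear_step S w"
  unfolding linear_step_def
proof
  fix v assume v: "v \<in> S"
  then obtain a where a: "v = u + \<epsilon> a" using assms(1) by auto
  then have "a \<noteq> b" using v assms(2,3) by auto
  then have "v + \<epsilon> b = w + \<epsilon> a" "w\<langle>a\<rangle> < v\<langle>a\<rangle>" by (simp_all add: a assms(2) add_ac)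
  then show "\<exists>w'\<in>S. \<exists>q c. w' + \<epsilon> c = w + \<epsilon> q \<and> w\<langle>q\<rangle> < v\<langle>q\<rangle>" using v by blast
qed

text \<open>
  Multiples of one monomial by variables have linear quotients in every order: \<open>(x\<^sub>a u) : (x\<^sub>b u)\<close> is
  generated by \<open>x\<^sub>a\<close>.
\<close>

lemma lin_quot_var_multiples:
  assumes "distinct xs" "set xs \<subseteq> range (\<lambda>a. u + \<epsilon> a)"
  shows "lin_quot xs"
  using assms
proof (induction xs rule: rev_induct)
  case (snoc w xs)
  then obtain b where "w = u + \<epsilon> b" by auto
  moreover have "w \<notin> set xs" "set xs \<subseteq> range (\<lambda>a. u + \<epsilon> a)" using snoc.prems by auto
  ultimately have "linear_step (set xs) w"
    using linear_step_var_multiples[of "set xs" u w b] by simp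
  then show ?case using snoc by (simp add: lin_quot_snoc)
qed simp

subsection \<open>The first homological shift\<close>

text \<open>
  For generators \<open>M\<close> of degree \<open>d\<close>, the monomials of degree \<open>d + 1\<close> that are divisible by at least two
  of them.
\<close>

definition shift_exps :: "('n \<Rightarrow>\<^sub>0 nat) set \<Rightarrow> ('n \<Rightarrow>\<^sub>0 nat) set"
  where "shift_exps M = {a. \<exists>v w i j. v \<in> M \<and> w \<in> M \<and> v \<noteq> w \<and> a = v + \<epsilon> i \<and> a = w + \<epsilon> j}"

lemma shift_expsI: "v \<in> M \<Longrightarrow> w \<in> M \<Longrightarrow> v \<noteq> w \<Longrightarrow> v + \<epsilon> i = w + \<epsilon> j \<Longrightarrow> v + \<epsilon> i \<in> shift_exps M"
  unfolding shift_exps_def by blast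

lemma shift_exps_insert:
  "shift_exps (insert u M) =
    shift_exps M \<union> {a. \<exists>v i j. v \<in> M \<and> v \<noteq> u \<and> a = v + \<epsilon> i \<and> a = u + \<epsilon> j}"
  unfolding shift_exps_def
proof (intro equalityI subsetI)
  fix a assume "a \<in> {a. \<exists>v w i j. v \<in> insert u M \<and> w \<in> insert u M \<and> v \<noteq> w \<and> a = v + \<epsilon> i \<and> a = w + \<epsilon> j}"
  then obtain v w i j where "v \<in> insert u M" "w \<in> insert u M" "v \<noteq> w" "a = v + \<epsilon> i" "a = w + \<epsilon> j"
    by blast
  then show "a \<in> {a. \<exists>v w i j. v \<in> M \<and> w \<in> M \<and> v \<noteq> w \<and> a = v + \<epsilon> i \<and> a = w + \<epsilon> j} \<union>
      {a. \<exists>v i j. v \<in> M \<and> v \<noteq> u \<and> a = v + \<epsilon> i \<and> a = u + \<epsilon> j}"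
    by (cases "v = u"; cases "w = u") blast+
qed blast

lemma nth_mem_take: "i < j \<Longrightarrow> j \<le> length xs \<Longrightarrow> xs ! i \<in> set (take j xs)"
  using nth_mem[of i "take j xs"] by simp

text \<open>
  Linear quotients single out, for \<open>u\<close> and an earlier \<open>v\<close>, a neighbour of \<open>u\<close> in the direction of
  \<open>v\<close>. The order of \<open>u\<close> and \<open>v\<close> does not matter: if \<open>v\<close> comes later, it has itself an
  earlier neighbour \<open>w\<close> in the direction of \<open>u\<close>, which does not exceed \<open>v\<close> in any variable in which
  it exceeds \<open>u\<close>; so one may replace \<open>v\<close> by \<open>w\<close> and descend.
\<close>

lemma linear_relations:
  assumes "lin_quot us" "u \<in> set us" "v \<in> set us" "u \<noteq> v"
  shows "\<exists>f\<in>set us. f \<noteq> u \<and> (\<exists>q c. f + \<epsilon> c = u + \<epsilon> q \<and> u\<langle>q\<rangle> < v\<langle>q\<rangle>)"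
proof -
  have *: "\<exists>f\<in>set us. f \<noteq> us ! i \<and> (\<exists>q c. f + \<epsilon> c = us ! i + \<epsilon> q \<and> (us ! i)\<langle>q\<rangle> < (us ! j)\<langle>q\<rangle>)"
    if "i < length us" "j < length us" "i \<noteq> j" for i j
    using that
  proof (induction j rule: less_induct)
    case (less j)
    have step: "\<exists>w\<in>set (take m us). \<exists>q c. w + \<epsilon> c = us ! m + \<epsilon> q \<and> (us ! m)\<langle>q\<rangle> < v\<langle>q\<rangle>"
      if "m < length us" "v \<in> set (take m us)" for m v
      using assms(1) that unfolding lin_quot_def linear_step_def by blast
    show ?case
    proof (cases "j < i")
      case True
      then have "us ! j \<in> set (take i us)" using less.prems by (intro nth_mem_take) auto
      from step[OF less.prems(1) this] obtain w q c
        where w: "w \<in> set (take i us)" "w + \<epsilon> c = us ! i + \<epsilon> q" "(us ! i)\<langle>q\<rangle> < (us ! j)\<langle>q\<rangle>"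
        by blast
      have "us ! i \<notin> set (take i us)"
        using assms(1) less.prems(1) by (auto simp: lin_quot_def in_set_conv_nth nth_eq_iff_index_eq)
      then have "w \<noteq> us ! i" using w(1) by blast
      then show ?thesis using w in_set_takeD[OF w(1)] by blast
    next
      case False
      then have "us ! i \<in> set (take j us)" using less.prems by (intro nth_mem_take) auto
      from step[OF less.prems(2) this] obtain w q c
        where w: "w \<in> set (take j us)" "w + \<epsilon> c = us ! j + \<epsilon> q" "(us ! j)\<langle>q\<rangle> < (us ! i)\<langle>q\<rangle>"
        by blast
      from w(1) obtain m where m: "m < j" "w = us ! m" using less.prems
        by (auto simp: in_set_conv_nth)
      have expo: "w\<langle>r\<rangle> + (\<epsilon> c)\<langle>r\<rangle> = (us ! j)\<langle>r\<rangle> + (\<epsilon> q)\<langle>r\<rangle>" for r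
        using w(2) by (metis expo_add)
      have "q \<noteq> c"
      proof
        assume "q = c"
        then have "us ! m = us ! j" using w(2) m(2) by simp
        then show False using assms(1) m less.prems by (simp add: lin_quot_def nth_eq_iff_index_eq)
      qed
      \<comment> \<open>If \<open>w\<close> happens to be \<open>us ! i\<close>, this relation read backwards is the one that is wanted.\<close>
      show ?thesis
      proof (cases "m = i")
        case True
        have "(us ! i)\<langle>c\<rangle> < (us ! j)\<langle>c\<rangle>" using expo[of c] \<open>q \<noteq> c\<close> True m by simp
        moreover have "us ! j + \<epsilon> q = us ! i + \<epsilon> c" using w(2) True m by simp
        moreover have "us ! j \<noteq> us ! i"
          using assms(1) less.prems by (simp add: lin_quot_def nth_eq_iff_index_eq)
        ultimately show ?thesis using nth_mem[OF less.prems(2)] by blast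
      next
        case False
        then obtain f r d where f: "f \<in> set us" "f \<noteq> us ! i" "f + \<epsilon> d = us ! i + \<epsilon> r" "(us ! i)\<langle>r\<rangle> < w\<langle>r\<rangle>"
          using less.IH[OF m(1) less.prems(1)] less.prems(2) m by auto
        have "w\<langle>r\<rangle> \<le> (us ! j)\<langle>r\<rangle> \<or> r = q \<and> w\<langle>r\<rangle> = (us ! j)\<langle>r\<rangle> + 1"
          using expo[of r] \<open>q \<noteq> c\<close> by (auto split: if_splits)
        then have "(us ! i)\<langle>r\<rangle> < (us ! j)\<langle>r\<rangle>" using f(4) w(3) by auto
        then show ?thesis using f by blast
      qed
    qed
  qed
  from assms(2,3) obtain i j where "i < length us" "j < length us" "u = us ! i" "v = us ! j"
    by (auto simp: in_set_conv_nth)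
  then show ?thesis using * assms(4) by metis
qed

text \<open>
  The list is built along with \<open>us\<close>. When the generator \<open>u\<close> is appended, the new monomials \<open>w\<close> are
  multiples of \<open>u\<close> by variables, hence harmless for each other. A new \<open>w\<close> has exactly one earlier
  divisor \<open>g\<close>. For an old \<open>v\<close>, a multiple of an earlier generator \<open>b\<close>, take the linear relation from
  \<open>g\<close> towards \<open>b\<close>: it gives an old monomial \<open>x\<^sub>q g\<close>, which cannot be \<open>w\<close> because \<open>w\<close> is new, and so
  \<open>(x\<^sub>q g) : w = x\<^sub>q\<close> divides \<open>v : w\<close>.
\<close>

lemma lin_quot_shift_exps:
  fixes us :: "('n::finite \<Rightarrow>\<^sub>0 nat) list"
  assumes "lin_quot us"
  shows "\<exists>vs. lin_quot vs \<and> set vs = shift_exps (set us)"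
  using assms
proof (induction us rule: rev_induct)
  case Nil
  show ?case by (rule exI[of _ "[]"]) (simp add: shift_exps_def)
next
  case (snoc u us)
  then have us: "lin_quot us" "u \<notin> set us" "linear_step (set us) u" by (simp_all add: lin_quot_snoc)
  obtain vs where vs: "lin_quot vs" "set vs = shift_exps (set us)" using snoc.IH us(1) by blast
  let ?N = "shift_exps (set (us @ [u])) - shift_exps (set us)"
  have N: "\<exists>g i l. g \<in> set us \<and> w = u + \<epsilon> i \<and> w = g + \<epsilon> l" if "w \<in> ?N" for w
    using that by (auto simp: shift_exps_insert)
  then have "?N \<subseteq> range (\<lambda>a. u + \<epsilon> a)" by blast
  moreover from finite_subset[OF this] have "finite ?N" by simp
  ultimately obtain ns where ns: "distinct ns" "set ns = ?N" "lin_quot ns"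
    by (metis finite_distinct_list lin_quot_var_multiples)
  have "lin_quot (vs @ ns)"
  proof (rule lin_quot_append[OF vs(1) ns(3)])
    show "set vs \<inter> set ns = {}" using vs(2) ns(2) by auto
    fix w assume "w \<in> set ns"
    then have w: "w \<in> ?N" by (simp add: ns(2))
    then obtain g l where g: "g \<in> set us" "w = g + \<epsilon> l" using N by blast
    show "linear_step (set vs) w" unfolding linear_step_def vs(2)
    proof
      fix v assume v: "v \<in> shift_exps (set us)"
      then obtain b p where b: "b \<in> set us" "v = b + \<epsilon> p" by (auto simp: shift_exps_def)
      have "w \<noteq> v" using v w by blast
      show "\<exists>z\<in>shift_exps (set us). \<exists>q c. z + \<epsilon> c = w + \<epsilon> q \<and> w\<langle>q\<rangle> < v\<langle>q\<rangle>"
      proof (cases "b = g")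
        case True
        then have "p \<noteq> l" using \<open>w \<noteq> v\<close> b g by auto
        then have "v + \<epsilon> l = w + \<epsilon> p" "w\<langle>p\<rangle> < v\<langle>p\<rangle>" using b g True by (simp_all add: add_ac)
        then show ?thesis using v by blast
      next
        case False
        then obtain f q c where f: "f \<in> set us" "f \<noteq> g" "f + \<epsilon> c = g + \<epsilon> q" "g\<langle>q\<rangle> < b\<langle>q\<rangle>"
          using linear_relations[OF us(1) g(1) b(1)] by blast
        have z: "g + \<epsilon> q \<in> shift_exps (set us)"
          using shift_expsI[OF g(1) f(1) f(2)[symmetric] f(3)[symmetric]] .
        then have "q \<noteq> l" using w g(2) by auto
        then have "(g + \<epsilon> q) + \<epsilon> l = w + \<epsilon> q" "w\<langle>q\<rangle> < v\<langle>q\<rangle>"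
          using f(4) by (simp_all add: g(2) b(2) add_ac)
        then show ?thesis using z by blast
      qed
    qed
  qed
  moreover have "set (vs @ ns) = shift_exps (set (us @ [u]))"
    using vs(2) ns(2) by (auto simp: shift_exps_insert)
  ultimately show ?case by blast
qed

section \<open>Powers of quadratic monomial ideals\<close>

lemma tdeg_eq_0_iff: "tdeg a = 0 \<longleftrightarrow> a = 0"
  by (simp add: tdeg_def exp_eq_iff)

lemma tdeg_1_cases:
  assumes "tdeg a = 1"
  obtains i where "a = \<epsilon> i"
proof -
  from assms have "a \<noteq> 0" using tdeg_eq_0_iff[of a] by simp
  then obtain i where "a\<langle>i\<rangle> \<noteq> 0" unfolding exp_eq_iff by auto
  then have "\<epsilon> i \<preceq> a" by (auto simp: divides_exp_def)
  then have "\<epsilon> i = a" by (rule divides_same_tdeg) (simp add: assms)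
  then show ?thesis using that by blast
qed

lemma tdeg_2_cases:
  assumes "tdeg a = 2" "a\<langle>i\<rangle> > 0"
  obtains j where "a = \<epsilon> i + \<epsilon> j"
proof -
  have "\<epsilon> i \<preceq> a" using assms(2) by (auto simp: divides_exp_def)
  then have a: "a = (a - \<epsilon> i) + \<epsilon> i" by (simp add: divides_diff_add)
  then have "tdeg a = tdeg (a - \<epsilon> i) + 1" by (metis tdeg_add tdeg_var_exp)
  then have "tdeg (a - \<epsilon> i) = 1" using assms(1) by simp
  then obtain j where "a - \<epsilon> i = \<epsilon> j" by (rule tdeg_1_cases)
  then have "a = \<epsilon> i + \<epsilon> j" using a by (metis add.commute)
  then show ?thesis by (rule that)
qed

text \<open>
  A factorization of a monomial into the generators \<open>gs\<close> is a multiset of indices into \<open>gs\<close>; the order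
  of the indices is the given order with linear quotients.
\<close>

definition prod_exp :: "('n \<Rightarrow>\<^sub>0 nat) list \<Rightarrow> nat multiset \<Rightarrow> ('n \<Rightarrow>\<^sub>0 nat)"
  where "prod_exp gs U = (\<Sum>m\<in>#U. gs ! m)"

lemma prod_exp_simps [simp]:
  "prod_exp gs {#} = 0"
  "prod_exp gs (add_mset m U) = gs ! m + prod_exp gs U"
  "prod_exp gs (U + V) = prod_exp gs U + prod_exp gs V"
  by (simp_all add: prod_exp_def)

lemma tdeg_prod_exp:
  assumes "\<And>g. g \<in> set gs \<Longrightarrow> tdeg g = d" "\<And>m. m \<in># U \<Longrightarrow> m < length gs"
  shows "tdeg (prod_exp gs U) = d * size U"
  using assms(2) by (induction U) (auto simp: assms(1) tdeg_eq_0_iff)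

lemma expo_prod_exp_pos:
  assumes "(prod_exp gs U)\<langle>q\<rangle> > 0"
  shows "\<exists>m\<in>#U. (gs ! m)\<langle>q\<rangle> > 0"
  using assms by (induction U) auto

text \<open>
  The core of the treatment of powers. Let \<open>e\<close> be the largest factor of \<open>U\<close>, and let \<open>V\<close> use only smaller
  factors. Then \<open>U\<close> can be changed into a multiset \<open>W\<close> with fewer copies of \<open>e\<close> and no larger factors
  whose product is that of \<open>U\<close>, or differs from it by one exchange of variables in the
  direction of \<open>V\<close>.

  If no variable \<open>x\<^sub>q\<close> has larger exponent in \<open>V\<close>, then \<open>V\<close> itself serves as \<open>W\<close>, by degrees. Otherwise
  take a factor \<open>f = x\<^sub>q x\<^sub>s\<close> of \<open>V\<close>. Since \<open>f < e\<close>, linear quotients of \<open>gs\<close> allow one to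
  replace \<open>e\<close> in \<open>U\<close> by a smaller generator, gaining \<open>x\<^sub>q\<close> or \<open>x\<^sub>s\<close>. This is what is wanted unless it gains an
  \<open>x\<^sub>s\<close> that is not in excess in \<open>V\<close>; but then \<open>x\<^sub>s\<close> occurs in a factor \<open>m = x\<^sub>s x\<^sub>t\<close> of \<open>U\<close>. If \<open>m = e\<close>, replace it by
  \<open>f\<close>. If not, remove \<open>m\<close> from \<open>U\<close> and \<open>f\<close> from \<open>V\<close> and recurse: in terms of graphs, this
  follows an alternating trail of \<open>V\<close>- and \<open>U\<close>-edges that starts in \<open>q\<close>. The only variable which the
  removal can bring into excess is \<open>x\<^sub>t\<close>, and a gain of \<open>x\<^sub>t\<close> becomes a gain of \<open>x\<^sub>q\<close> when \<open>f\<close> instead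
  of \<open>m\<close> is put back.
\<close>

lemma exchange_leading_factor:
  fixes gs :: "('n::finite \<Rightarrow>\<^sub>0 nat) list"
  assumes lin_quot: "lin_quot gs" and deg: "\<And>g. g \<in> set gs \<Longrightarrow> tdeg g = 2" and e: "e < length gs"
    and "e \<in># U" "\<And>m. m \<in># U \<Longrightarrow> m \<le> e" "\<And>m. m \<in># V \<Longrightarrow> m < e" "size U \<le> size V"
  shows "\<exists>W. size W = size U \<and> (\<forall>m\<in>#W. m \<le> e) \<and> count W e < count U e \<and>
    (prod_exp gs W = prod_exp gs U \<or>
      (\<exists>q c. prod_exp gs W + \<epsilon> c = prod_exp gs U + \<epsilon> q \<and> (prod_exp gs U)\<langle>q\<rangle> < (prod_exp gs V)\<langle>q\<rangle>))"
    (is "\<exists>W. ?good U V W")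
  using assms(4-7)
proof (induction U arbitrary: V rule: measure_induct_rule[of size])
  case (less U)
  let ?D = "prod_exp gs"
  note eU = less.prems(1) and Ule = less.prems(2) and Vlt = less.prems(3)
  show ?case
  proof (cases "\<forall>q. (?D V)\<langle>q\<rangle> \<le> (?D U)\<langle>q\<rangle>")
    case True
    have "tdeg (?D V) = 2 * size V"
      by (rule tdeg_prod_exp) (use deg Vlt e in auto, use Vlt e in force)
    moreover have "tdeg (?D U) = 2 * size U"
      by (rule tdeg_prod_exp) (use deg Ule e in auto, use Ule e in force)
    ultimately have "?D V = ?D U" "size V = size U"
      using True less.prems(4) divides_same_tdeg[of "?D V" "?D U"]
      by (auto simp: divides_exp_def)
    moreover have "count V e = 0" using Vlt by (metis count_inI less_irrefl)
    moreover have "0 < count U e" using eU by simp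
    ultimately have "?good U V V" using Vlt by (auto simp: less_imp_le)
    then show ?thesis by blast
  next
    case False
    then obtain q where q: "(?D U)\<langle>q\<rangle> < (?D V)\<langle>q\<rangle>" by (auto simp: not_le)
    then obtain f where f: "f \<in># V" "(gs ! f)\<langle>q\<rangle> > 0"
      using expo_prod_exp_pos[of gs V q] by auto
    have fe: "f < e" using Vlt f(1) by blast
    then have fl: "f < length gs" using e by simp
    then obtain s where s: "gs ! f = \<epsilon> q + \<epsilon> s"
      using tdeg_2_cases[OF deg[OF nth_mem[OF fl]] f(2)] by blast
    obtain U0 where U0: "U = add_mset e U0" using eU by (metis multi_member_split)
    obtain V0 where V0: "V = add_mset f V0" using f(1) by (metis multi_member_split)
    have U0le: "\<And>m. m \<in># U0 \<Longrightarrow> m \<le> e" using Ule U0 by auto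
    have "gs ! f \<in> set (take e gs)" using fe e by (intro nth_mem_take) auto
    then have "\<exists>w\<in>set (take e gs). \<exists>r c. w + \<epsilon> c = gs ! e + \<epsilon> r \<and> (gs ! e)\<langle>r\<rangle> < (gs ! f)\<langle>r\<rangle>"
      using lin_quot e unfolding lin_quot_def linear_step_def by blast
    then obtain w r c where w: "w \<in> set (take e gs)" "w + \<epsilon> c = gs ! e + \<epsilon> r" "(gs ! e)\<langle>r\<rangle> < (gs ! f)\<langle>r\<rangle>"
      by blast
    then obtain l where "l < e" "w = gs ! l" by (auto simp: in_set_conv_nth)
    with w have l: "l < e" "gs ! l + \<epsilon> c = gs ! e + \<epsilon> r" "(gs ! e)\<langle>r\<rangle> < (gs ! f)\<langle>r\<rangle>"
      by simp_all
    then have r: "r = q \<or> r = s" by (auto simp: s split: if_splits)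
    show ?thesis
    proof (cases "(?D U)\<langle>r\<rangle> < (?D V)\<langle>r\<rangle>")
      case True
      have "?D (add_mset l U0) + \<epsilon> c = (gs ! l + \<epsilon> c) + ?D U0" by (simp add: add_ac)
      also have "\<dots> = ?D U + \<epsilon> r" unfolding l(2) by (simp add: U0 add_ac)
      finally have "?D (add_mset l U0) + \<epsilon> c = ?D U + \<epsilon> r" .
      moreover have "count (add_mset l U0) e < count U e" "size (add_mset l U0) = size U"
        using l(1) U0 by auto
      ultimately have "?good U V (add_mset l U0)" using True U0le l(1) by auto
      then show ?thesis by blast
    next
      case False
      then have "r = s" "s \<noteq> q" using r q by auto
      have "0 < (?D V)\<langle>s\<rangle>" using V0 s by simp
      then have "0 < (?D U)\<langle>s\<rangle>" using False \<open>r = s\<close> by simp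
      then obtain m where m: "m \<in># U" "(gs ! m)\<langle>s\<rangle> > 0"
        using expo_prod_exp_pos[of gs U s] by blast
      then have ml: "m < length gs" using Ule e by force
      then obtain t where t: "gs ! m = \<epsilon> s + \<epsilon> t"
        using tdeg_2_cases[OF deg[OF nth_mem[OF ml]] m(2)] by blast
      show ?thesis
      proof (cases "m = e")
        case True
        have "?D (add_mset f U0) + \<epsilon> t = ?D U + \<epsilon> q" using U0 s t True by (simp add: add_ac)
        moreover have "count (add_mset f U0) e < count U e" "size (add_mset f U0) = size U"
          using fe U0 by auto
        ultimately have "?good U V (add_mset f U0)" using q U0le fe by auto
        then show ?thesis by blast
      next
        case False
        obtain U1 where U1: "U = add_mset m U1" using m(1) by (metis multi_member_split)
        have "e \<in># U1" using eU U1 False by auto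
        moreover have "size U1 \<le> size V0" "size U1 < size U" using less.prems(4) U1 V0 by auto
        moreover have "\<And>m. m \<in># U1 \<Longrightarrow> m \<le> e" "\<And>m. m \<in># V0 \<Longrightarrow> m < e"
          using Ule Vlt U1 V0 by auto
        ultimately obtain W where W: "?good U1 V0 W" using less.IH[of U1 V0] by blast
        have cnt: "count U e = count U1 e" using U1 False by simp
        have meq: "m \<le> e" using Ule m(1) by blast
        from W consider "?D W = ?D U1"
          | q' c' where "?D W + \<epsilon> c' = ?D U1 + \<epsilon> q'" "(?D U1)\<langle>q'\<rangle> < (?D V0)\<langle>q'\<rangle>" by blast
        then show ?thesis
        proof cases
          case 1
          then have "?good U V (add_mset m W)" using W cnt U1 meq False by auto
          then show ?thesis by blast
        next
          case (2 q' c')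
          \<comment> \<open>Put \<open>m\<close> back, unless the gain is the \<open>x\<^sub>t\<close> that only the removal of \<open>m\<close> brought into excess;
            then put \<open>f\<close> back, which turns the gain of \<open>x\<^sub>t\<close> into a gain of \<open>x\<^sub>q\<close>.\<close>
          show ?thesis
          proof (cases "(?D U)\<langle>q'\<rangle> < (?D V)\<langle>q'\<rangle>")
            case True
            have "?D (add_mset m W) + \<epsilon> c' = ?D U + \<epsilon> q'" using 2(1) U1 by (simp add: add.assoc)
            then have "?good U V (add_mset m W)" using W cnt U1 meq False True by auto
            then show ?thesis by blast
          next
            case nq: False
            have "(?D U)\<langle>q'\<rangle> + (gs ! f)\<langle>q'\<rangle> < (?D V)\<langle>q'\<rangle> + (gs ! m)\<langle>q'\<rangle>"
              using 2(2) U1 V0 by simp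
            then have "q' = t" using nq by (auto simp: s t split: if_splits)
            have "?D (add_mset f W) + \<epsilon> c' = \<epsilon> q + \<epsilon> s + (?D W + \<epsilon> c')"
              by (simp add: s add_ac)
            also have "\<dots> = ?D U + \<epsilon> q" unfolding 2(1) by (simp add: U1 \<open>q' = t\<close> t add_ac)
            finally have "?D (add_mset f W) + \<epsilon> c' = ?D U + \<epsilon> q" .
            then have "?good U V (add_mset f W)" using W cnt U1 fe q by auto
            then show ?thesis by blast
          qed
        qed
      qed
    qed
  qed
qed

lemma mset_less_of_leading_count:
  fixes U W :: "nat multiset"
  assumes "\<And>m. m \<in># W \<Longrightarrow> m \<le> e" "count W e < count U e"
  shows "W < U"
  unfolding less_multiset\<^sub>H\<^sub>O
proof (intro conjI allI impI)
  show "W \<noteq> U" using assms(2) by auto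
  fix y assume "count U y < count W y"
  then have "y \<in># W" by (metis count_inI not_less_zero)
  then have "y < e" using assms(1)[of y] assms(2) \<open>count U y < count W y\<close>
    by (metis le_neq_implies_less not_less_iff_gr_or_eq)
  then show "\<exists>x>y. count W x < count U x" using assms(2) by blast
qed

definition power_exps :: "('n \<Rightarrow>\<^sub>0 nat) list \<Rightarrow> nat \<Rightarrow> ('n \<Rightarrow>\<^sub>0 nat) set"
  where "power_exps gs k = prod_exp gs ` {U. size U = k \<and> set_mset U \<subseteq> {..<length gs}}"

lemma finite_multisets_of_size:
  assumes "finite A"
  shows "finite {U. size U = k \<and> set_mset U \<subseteq> A}"
proof (rule finite_subset)
  show "{U. size U = k \<and> set_mset U \<subseteq> A} \<subseteq> mset ` {xs. set xs \<subseteq> A \<and> length xs = k}"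
  proof
    fix U assume "U \<in> {U. size U = k \<and> set_mset U \<subseteq> A}"
    moreover obtain xs where "mset xs = U" using ex_mset by blast
    ultimately show "U \<in> mset ` {xs. set xs \<subseteq> A \<and> length xs = k}" by auto
  qed
qed (simp add: finite_lists_length_eq assms)

text \<open>
  Each generator of the power is represented by its least factorization, and generators are
  ordered by these. For \<open>V < U\<close>, remove the common factors; the largest index \<open>e\<close> left is then in \<open>U\<close>, and
  the exchange lemma applies. The resulting \<open>W\<close> is smaller than \<open>U\<close>, so it cannot have the same
  product by minimality of \<open>U\<close>; it is the required linear step.
\<close>

lemma lin_quot_power_exps:
  fixes gs :: "('n::finite \<Rightarrow>\<^sub>0 nat) list"
  assumes lin_quot: "lin_quot gs" and deg: "\<And>g. g \<in> set gs \<Longrightarrow> tdeg g = 2"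
  shows "\<exists>us. lin_quot us \<and> set us = power_exps gs k"
proof -
  let ?D = "prod_exp gs"
  define F where "F = {U. size U = k \<and> set_mset U \<subseteq> {..<length gs}}"
  define T where "T = {U \<in> F. \<forall>W\<in>F. ?D W = ?D U \<longrightarrow> U \<le> W}"
  have finF: "finite F" unfolding F_def by (rule finite_multisets_of_size) simp
  have finT: "finite T" using finF by (simp add: T_def)
  have std: "\<exists>W'\<in>T. ?D W' = ?D W \<and> W' \<le> W" if "W \<in> F" for W
  proof -
    let ?S = "{W' \<in> F. ?D W' = ?D W}"
    have S: "finite ?S" "?S \<noteq> {}" using finF that by auto
    have "Min ?S \<in> ?S" using Min_in[OF S] .
    moreover have "\<And>X. X \<in> ?S \<Longrightarrow> Min ?S \<le> X" using Min_le[OF S(1)] .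
    ultimately show ?thesis using that unfolding T_def by (intro bexI[of _ "Min ?S"]) auto
  qed
  have inj: "inj_on ?D T"
  proof (rule inj_onI)
    fix U W assume "U \<in> T" "W \<in> T" "?D U = ?D W"
    then have "U \<le> W" "W \<le> U" by (simp_all add: T_def)
    then show "U = W" by (rule antisym)
  qed
  define ts where "ts = sorted_list_of_set T"
  have ts: "set ts = T" "distinct ts" "sorted ts" by (simp_all add: ts_def finT)
  have key: "\<exists>W\<in>T. W < U \<and> (\<exists>q c. ?D W + \<epsilon> c = ?D U + \<epsilon> q \<and> (?D U)\<langle>q\<rangle> < (?D V)\<langle>q\<rangle>)"
    if U: "U \<in> T" and V: "V \<in> T" and VU: "V < U" for U V
  proof -
    define C where "C = U \<inter># V"
    define U0 where "U0 = U - C"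
    define V0 where "V0 = V - C"
    have UC: "U = U0 + C" "V = V0 + C"
      by (auto simp: U0_def V0_def C_def multiset_eq_iff)
    have cnt: "count U0 y = count U y - count V y" "count V0 y = count V y - count U y" for y
      by (simp_all add: U0_def V0_def C_def)
    have sz: "size U0 = size V0"
    proof -
      have "size U = size V" using U V by (simp add: T_def F_def)
      then show ?thesis using UC by (metis add_right_cancel size_union)
    qed
    have "U0 \<noteq> {#}" using VU UC sz by auto
    define e where "e = Max (set_mset U0)"
    have e: "e \<in># U0" unfolding e_def using \<open>U0 \<noteq> {#}\<close> by (intro Max_in) auto
    have U0e: "m \<le> e" if "m \<in># U0" for m unfolding e_def using that by (intro Max_ge) auto
    have V0e: "m < e" if "m \<in># V0" for m
    proof -
      have "count U m < count V m" using that cnt(2)[of m] by (metis count_greater_zero_iff zero_less_diff)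
      then obtain x where "x > m" "count V x < count U x"
        using VU unfolding less_multiset\<^sub>H\<^sub>O by blast
      then have "x \<in># U0" using cnt(1)[of x] by (metis count_greater_zero_iff zero_less_diff)
      then show ?thesis using U0e \<open>x > m\<close> by fastforce
    qed
    have Usub: "set_mset U \<subseteq> {..<length gs}" "size U = k" using U by (auto simp: T_def F_def)
    then have el: "e < length gs" using e UC(1) by auto
    obtain W0 where W0: "size W0 = size U0" "\<forall>m\<in>#W0. m \<le> e" "count W0 e < count U0 e"
      "?D W0 = ?D U0 \<or> (\<exists>q c. ?D W0 + \<epsilon> c = ?D U0 + \<epsilon> q \<and> (?D U0)\<langle>q\<rangle> < (?D V0)\<langle>q\<rangle>)"
      using exchange_leading_factor[OF lin_quot deg el e U0e V0e, of V0] sz by auto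
    define W where "W = W0 + C"
    have WU: "W < U" using mset_less_of_leading_count[of W0 e U0] W0(2,3) by (simp add: W_def UC(1))
    have WF: "W \<in> F" using W0(1,2) el Usub unfolding F_def W_def UC(1) by auto
    have "?D W \<noteq> ?D U" using U WU WF unfolding T_def by (auto simp: not_less[symmetric])
    then obtain q c where q: "?D W0 + \<epsilon> c = ?D U0 + \<epsilon> q" "(?D U0)\<langle>q\<rangle> < (?D V0)\<langle>q\<rangle>"
      using W0(4) by (auto simp: W_def UC(1))
    obtain W' where W': "W' \<in> T" "?D W' = ?D W" "W' \<le> W" using std[OF WF] by blast
    have "?D W' + \<epsilon> c = (?D W0 + \<epsilon> c) + ?D C" by (simp add: W'(2) W_def add_ac)
    also have "\<dots> = ?D U + \<epsilon> q" unfolding q(1) by (simp add: UC(1) add_ac)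
    finally have "?D W' + \<epsilon> c = ?D U + \<epsilon> q" .
    moreover have "(?D U)\<langle>q\<rangle> < (?D V)\<langle>q\<rangle>" using q(2) by (simp add: UC)
    ultimately show ?thesis using W'(1,3) WU le_less_trans by blast
  qed
  have less: "ts ! i < ts ! j" if "i < j" "j < length ts" for i j
    using that ts(2,3) by (metis le_neq_trans less_imp_neq nth_eq_iff_index_eq order.strict_trans sorted_nth_mono less_imp_le)
  have "lin_quot (map ?D ts)"
    unfolding lin_quot_def linear_step_def
  proof (intro conjI allI impI ballI)
    show "distinct (map ?D ts)" using inj ts by (simp add: distinct_map)
    fix j v assume j: "j < length (map ?D ts)" and "v \<in> set (take j (map ?D ts))"
    then obtain i where i: "i < j" "v = ?D (ts ! i)" by (auto simp: in_set_conv_nth)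
    have "ts ! i \<in> T" "ts ! j \<in> T" using i(1) j ts(1) by (auto simp del: ts simp: ts(1)[symmetric])
    from key[OF this(2,1) less] obtain W q c where W: "W \<in> T" "W < ts ! j"
        "?D W + \<epsilon> c = ?D (ts ! j) + \<epsilon> q" "(?D (ts ! j))\<langle>q\<rangle> < v\<langle>q\<rangle>"
      using i j by auto
    obtain l where l: "l < length ts" "W = ts ! l" using W(1) ts(1) by (metis in_set_conv_nth)
    have "l < j"
      using l W(2) less[of j l] by (metis less_asym less_irrefl nat_neq_iff)
    then have "?D W \<in> set (take j (map ?D ts))"
      using nth_mem_take[of l j "map ?D ts"] j l by simp
    then show "\<exists>w\<in>set (take j (map ?D ts)). \<exists>q c. w + \<epsilon> c = map ?D ts ! j + \<epsilon> q \<and>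
        (map ?D ts ! j)\<langle>q\<rangle> < v\<langle>q\<rangle>"
      using W(3,4) j by (intro bexI[of _ "?D W"]) auto
  qed
  moreover have "set (map ?D ts) = power_exps gs k"
  proof -
    have "T \<subseteq> F" by (auto simp: T_def)
    moreover have "?D ` F \<subseteq> ?D ` T" using std by (metis image_eqI image_subsetI)
    ultimately have "?D ` T = ?D ` F" by blast
    then show ?thesis by (simp add: power_exps_def F_def ts(1))
  qed
  ultimately show ?thesis by blast
qed

lemma power_exps_0: "power_exps gs 0 = {0}"
  by (auto simp: power_exps_def intro!: image_eqI[of _ _ "{#}"])

lemma power_exps_Suc:
  "power_exps gs (Suc k) = {a + b | a b. a \<in> set gs \<and> b \<in> power_exps gs k}"
proof (intro equalityI subsetI)
  fix x assume "x \<in> power_exps gs (Suc k)"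
  then obtain U where U: "x = prod_exp gs U" "size U = Suc k" "set_mset U \<subseteq> {..<length gs}"
    by (auto simp: power_exps_def)
  then obtain m U' where "U = add_mset m U'" by (metis size_eq_Suc_imp_eq_union)
  then have "x = gs ! m + prod_exp gs U'" "m < length gs" "prod_exp gs U' \<in> power_exps gs k"
    using U by (auto simp: power_exps_def)
  then show "x \<in> {a + b | a b. a \<in> set gs \<and> b \<in> power_exps gs k}" using nth_mem by blast
next
  fix x assume "x \<in> {a + b | a b. a \<in> set gs \<and> b \<in> power_exps gs k}"
  then obtain m U where "x = gs ! m + prod_exp gs U" "m < length gs" "size U = k"
      "set_mset U \<subseteq> {..<length gs}"
    by (auto simp: power_exps_def in_set_conv_nth)
  then show "x \<in> power_exps gs (Suc k)"
    unfolding power_exps_def by (intro image_eqI[of _ _ "add_mset m U"]) auto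
qed

lemma ideal_power_eq:
  assumes "(I :: ('n, 'k::field) pring set) = ideal_gen (monom ` set gs)"
  shows "ideal_power I k = ideal_gen (monom ` power_exps gs k)"
  by (induction k) (simp_all add: assms power_exps_0 ideal_gen_UNIV power_exps_Suc ideal_mult_monom
      del: image_insert image_empty)

section \<open>Linear quotients, Koszul homology and linear resolutions\<close>

lemma mem_koszul_simplices: "A \<in> koszul_simplices U a \<longleftrightarrow> (\<exists>b\<in>U. a = b + set_exp A)"
proof
  assume "A \<in> koszul_simplices U a"
  then have "a - set_exp A \<in> U" "a = (a - set_exp A) + set_exp A"
    by (simp_all add: koszul_simplices_def divides_diff_add)
  then show "\<exists>b\<in>U. a = b + set_exp A" by blast
qed (auto simp: koszul_simplices_def)

lemma down_closed_koszul_simplices: "down_closed (koszul_simplices (upset M) a)"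
  unfolding down_closed_def
proof (intro ballI allI impI)
  fix A B assume "A \<in> koszul_simplices (upset M) a" "B \<subseteq> A"
  then obtain b where b: "b \<in> upset M" "a = b + set_exp A" by (auto simp: mem_koszul_simplices)
  have "set_exp A = set_exp (A - B) + set_exp B"
    using \<open>B \<subseteq> A\<close> by (auto simp: exp_eq_iff)
  then have "a = (b + set_exp (A - B)) + set_exp B" by (simp add: b add.assoc)
  then show "B \<in> koszul_simplices (upset M) a"
    using upset_add(1)[OF b(1)] by (auto simp: mem_koszul_simplices)
qed

text \<open>The variables in the colon ideal \<open>(S) : x\<^sup>u\<close>.\<close>

definition colon_vars :: "('n \<Rightarrow>\<^sub>0 nat) set \<Rightarrow> ('n \<Rightarrow>\<^sub>0 nat) \<Rightarrow> 'n set"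
  where "colon_vars S u = {q. u + \<epsilon> q \<in> upset S}"

lemma add_mem_upset_iff:
  assumes "linear_step S u"
  shows "m + u \<in> upset S \<longleftrightarrow> (\<exists>q\<in>colon_vars S u. m\<langle>q\<rangle> > 0)"
proof
  assume "m + u \<in> upset S"
  then obtain v where v: "v \<in> S" "v \<preceq> m + u" by (auto simp: upset_def)
  then obtain w q c where w: "w \<in> S" "w + \<epsilon> c = u + \<epsilon> q" "u\<langle>q\<rangle> < v\<langle>q\<rangle>"
    using assms unfolding linear_step_def by blast
  have "w \<preceq> u + \<epsilon> q" unfolding w(2)[symmetric] by simp
  then have "q \<in> colon_vars S u" using w(1) by (auto simp: colon_vars_def upset_def)
  moreover have "v\<langle>q\<rangle> \<le> m\<langle>q\<rangle> + u\<langle>q\<rangle>" using v(2) by (simp add: divides_exp_def)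
  ultimately show "\<exists>q\<in>colon_vars S u. m\<langle>q\<rangle> > 0" using w(3) by (intro bexI[of _ q]) auto
next
  assume "\<exists>q\<in>colon_vars S u. m\<langle>q\<rangle> > 0"
  then obtain q where q: "u + \<epsilon> q \<in> upset S" "m\<langle>q\<rangle> > 0" by (auto simp: colon_vars_def)
  have "u + \<epsilon> q \<preceq> m + u" using q(2) by (auto simp: divides_exp_def)
  then show "m + u \<in> upset S" using upset_divides q(1) by blast
qed

text \<open>
  When \<open>u\<close> is added to the generators, the new faces \<open>A\<close> are those with \<open>x\<^sup>a = x\<^sup>m x\<^sup>u x\<^sup>A\<close> where \<open>x\<^sup>m\<close> avoids
  the variables \<open>V\<close> of the colon ideal. A variable \<open>p\<close> outside \<open>V\<close> dividing \<open>x\<^sup>a / x\<^sup>u\<close> can be moved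
  freely between \<open>A\<close> and \<open>m\<close>, so the relative complex is a cone. If there is none, then \<open>m = 0\<close>, and
  the cardinality of \<open>A\<close> is \<open>tdeg a - d\<close>.
\<close>

lemma lin_quot_acyclic_at:
  fixes us :: "('n::{finite, linorder} \<Rightarrow>\<^sub>0 nat) list"
  assumes "lin_quot us" "\<And>u. u \<in> set us \<Longrightarrow> tdeg u = d" "tdeg a \<noteq> i + d"
  shows "acyclic_at TYPE('k::field) (koszul_simplices (upset (set us)) a) i"
  using assms(1,2)
proof (induction us rule: rev_induct)
  case Nil
  have "koszul_simplices (upset (set [])) a = {}" by (simp add: koszul_simplices_def upset_def)
  then show ?case by (simp only: acyclic_at_empty)
next
  case (snoc u us)
  let ?\<Delta> = "koszul_simplices (upset (set us)) a" and ?\<Delta>' = "koszul_simplices (upset (set (us @ [u]))) a"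
  let ?V = "colon_vars (set us) u"
  have step: "linear_step (set us) u" using snoc.prems(1) by (simp add: lin_quot_snoc)
  have ac: "acyclic_at TYPE('k) ?\<Delta> i" using snoc by (simp add: lin_quot_snoc)
  have sub: "?\<Delta> \<subseteq> ?\<Delta>'"
    using upset_mono[of "set us" "set (us @ [u])"] by (fastforce simp: mem_koszul_simplices)
  have R: "A \<in> ?\<Delta>' - ?\<Delta> \<longleftrightarrow> (\<exists>m. a = m + u + set_exp A \<and> (\<forall>q\<in>?V. m\<langle>q\<rangle> = 0))" for A
  proof
    assume A: "A \<in> ?\<Delta>' - ?\<Delta>"
    then obtain b where b: "b \<in> upset (set (us @ [u]))" "a = b + set_exp A"
      by (auto simp: mem_koszul_simplices)
    moreover have "b \<notin> upset (set us)" using A b(2) by (auto simp: mem_koszul_simplices)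
    ultimately have "u \<preceq> b" by (auto simp: upset_def)
    then have bm: "b = (b - u) + u" by (simp add: divides_diff_add)
    have "\<forall>q\<in>?V. (b - u)\<langle>q\<rangle> = 0"
      using add_mem_upset_iff[OF step, of "b - u"] \<open>b \<notin> upset (set us)\<close> bm by auto
    then show "\<exists>m. a = m + u + set_exp A \<and> (\<forall>q\<in>?V. m\<langle>q\<rangle> = 0)"
      using b(2) bm by (intro exI[of _ "b - u"]) auto
  next
    assume "\<exists>m. a = m + u + set_exp A \<and> (\<forall>q\<in>?V. m\<langle>q\<rangle> = 0)"
    then obtain m where m: "a = m + u + set_exp A" "\<forall>q\<in>?V. m\<langle>q\<rangle> = 0" by blast
    have "m + u \<notin> upset (set us)" using add_mem_upset_iff[OF step, of m] m(2) by auto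
    moreover have "m + u \<in> upset (set (us @ [u]))" by (auto simp: upset_def)
    ultimately show "A \<in> ?\<Delta>' - ?\<Delta>" using m(1) by (auto simp: mem_koszul_simplices)
  qed
  show ?case
  proof (cases "\<exists>p. p \<notin> ?V \<and> u\<langle>p\<rangle> < a\<langle>p\<rangle>")
    case True
    then obtain p where p: "p \<notin> ?V" "u\<langle>p\<rangle> < a\<langle>p\<rangle>" by blast
    show ?thesis
    proof (rule relative_cone[OF sub down_closed_koszul_simplices down_closed_koszul_simplices _ ac])
      fix A assume "A \<in> ?\<Delta>' - ?\<Delta>"
      then obtain m where m: "a = m + u + set_exp A" "\<forall>q\<in>?V. m\<langle>q\<rangle> = 0"
        unfolding R by blast
      have mp: "m\<langle>p\<rangle> > 0" if "p \<notin> A" using p(2) m(1) that by simp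
      have "insert p A \<in> ?\<Delta>' - ?\<Delta>"
      proof (cases "p \<in> A")
        case False
        have "a = (m - \<epsilon> p) + u + set_exp (insert p A)"
          using mp[OF False] False by (auto simp: m(1) exp_eq_iff)
        then show ?thesis unfolding R using m(2) by (intro exI[of _ "m - \<epsilon> p"]) auto
      qed (use \<open>A \<in> ?\<Delta>' - ?\<Delta>\<close> in \<open>simp add: insert_absorb\<close>)
      moreover have "A - {p} \<in> ?\<Delta>' - ?\<Delta>"
      proof (cases "p \<in> A")
        case True
        have "a = (m + \<epsilon> p) + u + set_exp (A - {p})"
          using True by (auto simp: m(1) exp_eq_iff)
        then show ?thesis unfolding R using m(2) p(1) by (intro exI[of _ "m + \<epsilon> p"]) auto
      qed (use \<open>A \<in> ?\<Delta>' - ?\<Delta>\<close> in simp)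
      ultimately show "insert p A \<in> ?\<Delta>' - ?\<Delta> \<and> A - {p} \<in> ?\<Delta>' - ?\<Delta>" by blast
    qed
  next
    case False
    have "card A \<noteq> i" if A: "A \<in> ?\<Delta>' - ?\<Delta>" for A
    proof
      assume "card A = i"
      from A obtain m where m: "a = m + u + set_exp A" "\<forall>q\<in>?V. m\<langle>q\<rangle> = 0"
        unfolding R by blast
      have "m\<langle>q\<rangle> = 0" for q
      proof (cases "q \<in> ?V")
        case nq: False
        then have "a\<langle>q\<rangle> \<le> u\<langle>q\<rangle>" using False by (meson not_less)
        then show ?thesis using m(1) by simp
      qed (use m(2) in blast)
      then have "m = 0" by (simp add: exp_eq_iff)
      then have "tdeg a = i + d" using m(1) \<open>card A = i\<close> snoc.prems(2)[of u] by simp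
      then show False using assms(3) by simp
    qed
    then show ?thesis using sub by (intro acyclic_at_cong[OF _ sub ac]) blast
  qed
qed

lemma Tor_multi_nonzero_iff:
  "Tor_multi_nonzero i (ideal_gen (monom ` M) :: ('n::{finite, linorder}, 'k::field) pring set) a \<longleftrightarrow>
    \<not> acyclic_at TYPE('k) (koszul_simplices (upset M) a) i"
  unfolding Tor_multi_nonzero_def
  by (subst homology_nonzero_iff[OF mem_ideal_gen_monom_iff]) simp

lemma Tor_nonzero_iff:
  "Tor_nonzero i (ideal_gen (monom ` M) :: ('n::{finite, linorder}, 'k::field) pring set) m \<longleftrightarrow>
    (\<exists>a. tdeg a = m \<and> \<not> acyclic_at TYPE('k) (koszul_simplices (upset M) a) i)"
  unfolding Tor_nonzero_def
  by (subst homology_nonzero_iff[OF mem_ideal_gen_monom_iff]) simp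

lemma lin_quot_imp_linear_resolution:
  fixes us :: "('n::{finite, linorder} \<Rightarrow>\<^sub>0 nat) list"
  assumes "lin_quot us" "\<And>u. u \<in> set us \<Longrightarrow> tdeg u = d"
  shows "linear_resolution (ideal_gen (monom ` set us) :: ('n, 'k::field) pring set)"
  unfolding linear_resolution_def
proof (intro disjI2 exI conjI allI impI)
  show "\<forall>f\<in>(monom ` set us :: ('n, 'k) pring set). homogeneous d f"
    using assms(2) by (auto simp: homogeneous_def monom_def)
  show "ideal_gen (monom ` set us) = (ideal_gen (monom ` set us) :: ('n, 'k) pring set)" ..
  fix i m assume "m \<noteq> i + d"
  then show "\<not> Tor_nonzero i (ideal_gen (monom ` set us) :: ('n, 'k) pring set) m"
    unfolding Tor_nonzero_iff using lin_quot_acyclic_at[OF assms, where ?'k = 'k] by blast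
qed

lemma lookup_mult_monom:
  fixes f :: "('n, 'k::field) pring"
  shows "Poly_Mapping.lookup (f * monom u) (m + u) = Poly_Mapping.lookup f m"
proof -
  have inner: "(\<Sum>q. Poly_Mapping.lookup (monom u :: ('n, 'k) pring) q when m + u = l + q) =
      (1 when l = m)" for l :: "'n \<Rightarrow>\<^sub>0 nat"
  proof -
    have eq: "(\<lambda>q. Poly_Mapping.lookup (monom u :: ('n, 'k) pring) q when m + u = l + q) =
        (\<lambda>q. (1 when l = m) when q = u)"
      by (auto simp: lookup_single when_def monom_def fun_eq_iff)
    show ?thesis unfolding eq by (rule Sum_any_when_equal)
  qed
  have eq: "(\<lambda>l. Poly_Mapping.lookup f l * (1 when l = m)) = (\<lambda>l. Poly_Mapping.lookup f l when l = m)"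
    by (auto simp: when_def)
  show ?thesis by (simp only: lookup_mult inner eq Sum_any_when_equal)
qed

lemma keys_mult_monom:
  fixes f :: "('n, 'k::field) pring"
  shows "Poly_Mapping.keys (f * monom u) = (\<lambda>m. m + u) ` Poly_Mapping.keys f"
proof
  show "Poly_Mapping.keys (f * monom u) \<subseteq> (\<lambda>m. m + u) ` Poly_Mapping.keys f"
    using keys_mult[of f "monom u"] by (auto simp: monom_def)
  show "(\<lambda>m. m + u) ` Poly_Mapping.keys f \<subseteq> Poly_Mapping.keys (f * monom u)"
    by (auto simp: in_keys_iff lookup_mult_monom)
qed

lemma colon_monom:
  assumes "linear_step S u"
  shows "colon (ideal_gen (monom ` S)) (monom u :: ('n, 'k::field) pring) =
    ideal_gen (Var ` colon_vars S u)"
proof -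
  have Var: "(Var ` colon_vars S u :: ('n, 'k) pring set) = monom ` (\<epsilon> ` colon_vars S u)"
    by (simp add: Var_eq_monom image_image)
  have up: "m \<in> upset (\<epsilon> ` colon_vars S u) \<longleftrightarrow> m + u \<in> upset S" for m
    unfolding add_mem_upset_iff[OF assms] by (force simp: upset_def divides_exp_def)
  have "f \<in> colon (ideal_gen (monom ` S)) (monom u) \<longleftrightarrow> f \<in> ideal_gen (Var ` colon_vars S u)"
    for f :: "('n, 'k) pring"
    unfolding colon_def Var mem_Collect_eq mem_ideal_gen_monom_iff keys_mult_monom
    by (auto simp: up)
  then show ?thesis by blast
qed

lemma lin_quot_imp_linear_quotients:
  fixes us :: "('n::finite \<Rightarrow>\<^sub>0 nat) list"
  assumes "lin_quot us" "\<And>u. u \<in> set us \<Longrightarrow> tdeg u = d"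
  shows "linear_quotients (ideal_gen (monom ` set us) :: ('n, 'k::field) pring set)"
  unfolding linear_quotients_def
proof (intro exI[of _ "map monom us"] conjI allI impI)
  show "distinct (map monom us :: ('n, 'k) pring list)"
    using assms(1) by (auto simp: lin_quot_def distinct_map inj_on_def)
  show "minimal_monomial_generating_set (ideal_gen (monom ` set us))
      (set (map monom us :: ('n, 'k) pring list))"
    unfolding minimal_monomial_generating_set_def
  proof (intro conjI allI impI)
    fix N :: "('n, 'k) pring set" assume N: "N \<subset> set (map monom us)"
    then have "N \<subseteq> monom ` set us" by auto
    then obtain N' where N': "N' \<subseteq> set us" "N = monom ` N'" by (auto simp: subset_image_iff)
    then obtain u where u: "u \<in> set us" "u \<notin> N'" using N by auto
    show "ideal_gen N \<noteq> ideal_gen (monom ` set us)"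
    proof
      assume "ideal_gen N = ideal_gen (monom ` set us)"
      then have "(monom u :: ('n, 'k) pring) \<in> ideal_gen (monom ` N')"
        using u(1) subset_upset[of "set us"] by (auto simp: N'(2) monom_mem_ideal_gen_iff)
      then obtain v where "v \<in> N'" "v \<preceq> u" by (auto simp: monom_mem_ideal_gen_iff upset_def)
      then have "v = u" using assms(2) u(1) N'(1) by (intro divides_same_tdeg) auto
      then show False using \<open>v \<in> N'\<close> u(2) by simp
    qed
  qed auto
  fix j assume j: "1 \<le> j \<and> j < length (map monom us :: ('n, 'k) pring list)"
  then have "linear_step (set (take j us)) (us ! j)" using assms(1) by (simp add: lin_quot_def)
  from colon_monom[OF this, where ?'k = 'k] j
  show "\<exists>V. colon (ideal_gen (set (take j (map monom us)))) (map monom us ! j :: ('n, 'k) pring) =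
      ideal_gen (Var ` V)"
    by (auto simp: take_map)
qed

subsection \<open>The first homological shift ideal\<close>

lemma upset_tdeg:
  assumes "\<And>u. u \<in> M \<Longrightarrow> tdeg u = d" "b \<in> upset M"
  shows "d \<le> tdeg b" "tdeg b = d \<Longrightarrow> b \<in> M"
proof -
  obtain v where v: "v \<in> M" "v \<preceq> b" using assms(2) by (auto simp: upset_def)
  then obtain c where "b = v + c" by (auto simp: divides_iff_ex_add)
  then show "d \<le> tdeg b" using assms(1)[OF v(1)] by simp
  show "tdeg b = d \<Longrightarrow> b \<in> M" using divides_same_tdeg[OF v(2)] v(1) assms(1) by auto
qed

text \<open>
  In degree \<open>d + 1\<close> the upper Koszul complex consists of isolated points, one for each generator
  dividing \<open>x\<^sup>a\<close>; it is acyclic in degree \<open>1\<close>, that is, connected, iff there is at most one of them.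
\<close>

lemma acyclic_at_1_iff:
  fixes M :: "('n::{finite, linorder} \<Rightarrow>\<^sub>0 nat) set"
  assumes deg: "\<And>u. u \<in> M \<Longrightarrow> tdeg u = d" and a: "tdeg a = Suc d"
  shows "acyclic_at TYPE('k::field) (koszul_simplices (upset M) a) 1 \<longleftrightarrow> a \<notin> shift_exps M"
proof -
  let ?\<Delta> = "koszul_simplices (upset M) a"
  have single: "{j} \<in> ?\<Delta> \<longleftrightarrow> (\<exists>b\<in>M. a = b + \<epsilon> j)" for j
  proof
    have sj: "set_exp {j} = \<epsilon> j" by (simp add: set_exp_def)
    show "{j} \<in> ?\<Delta> \<Longrightarrow> \<exists>b\<in>M. a = b + \<epsilon> j"
      using upset_tdeg(2)[OF deg] a by (auto simp: mem_koszul_simplices sj)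
    show "\<exists>b\<in>M. a = b + \<epsilon> j \<Longrightarrow> {j} \<in> ?\<Delta>"
      using subset_upset[of M] by (auto simp: mem_koszul_simplices sj)
  qed
  have pairs: "A \<notin> ?\<Delta>" if "card A = Suc 1" for A
  proof
    assume "A \<in> ?\<Delta>"
    then obtain b where "b \<in> upset M" "a = b + set_exp A" by (auto simp: mem_koszul_simplices)
    then show False using upset_tdeg(1)[OF deg] a that by fastforce
  qed
  have chain2: "\<delta> = (\<lambda>_. 0)" if "chain_on ?\<Delta> (Suc 1) \<delta>" for \<delta> :: "'n set \<Rightarrow> 'k"
    using that pairs unfolding chain_on_def by blast
  have bd: "bdry \<gamma> = (\<lambda>A. if A = {} then \<Sum>j\<in>UNIV. \<gamma> {j} else 0)"
    if "chain_on ?\<Delta> 1 \<gamma>" for \<gamma> :: "'n set \<Rightarrow> 'k"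
  proof
    fix A :: "'n set"
    show "bdry \<gamma> A = (if A = {} then \<Sum>j\<in>UNIV. \<gamma> {j} else 0)"
    proof (cases "A = {}")
      case True
      have "{l \<in> {j}. l < j} = {}" for j :: 'n by auto
      then have "(ksign j {j} :: 'k) = 1" for j :: 'n
        unfolding ksign_def by (simp only: card.empty power_0)
      then show ?thesis using True by (simp add: bdry_def)
    next
      case False
      have "\<gamma> (insert j A) = 0" if "j \<notin> A" for j
      proof (rule ccontr)
        assume "\<gamma> (insert j A) \<noteq> 0"
        then have "card (insert j A) = 1" using \<open>chain_on ?\<Delta> 1 \<gamma>\<close> by (auto simp: chain_on_def)
        then show False using that False by simp
      qed
      then show ?thesis using False by (simp add: bdry_def)
    qed
  qed
  show ?thesis
  proof
    assume ac: "acyclic_at TYPE('k) ?\<Delta> 1"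
    show "a \<notin> shift_exps M"
    proof
      assume "a \<in> shift_exps M"
      then obtain v w i j where vw: "v \<in> M" "w \<in> M" "v \<noteq> w" "a = v + \<epsilon> i" "a = w + \<epsilon> j"
        unfolding shift_exps_def by blast
      then have "i \<noteq> j" by auto
      define \<gamma> :: "'n set \<Rightarrow> 'k" where "\<gamma> A = (if A = {i} then 1 else if A = {j} then - 1 else 0)" for A
      have ch: "chain_on ?\<Delta> 1 \<gamma>"
      proof -
        have "{i} \<in> ?\<Delta>" "{j} \<in> ?\<Delta>" unfolding single using vw by blast+
        then show ?thesis by (auto simp: chain_on_def \<gamma>_def)
      qed
      have "(\<Sum>l\<in>UNIV. \<gamma> {l}) = (\<Sum>l\<in>UNIV. (if l = i then 1 else 0) + (if l = j then - 1 else 0))"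
        using \<open>i \<noteq> j\<close> by (intro sum.cong) (auto simp: \<gamma>_def)
      also have "\<dots> = 0" by (simp add: sum.distrib)
      finally have "bdry \<gamma> = (\<lambda>_. 0)" by (simp add: bd[OF ch] fun_eq_iff)
      then obtain \<delta> where \<delta>: "chain_on ?\<Delta> (Suc 1) \<delta>" "bdry \<delta> = \<gamma>"
        using ac ch unfolding acyclic_at_def by blast
      have "\<gamma> = (\<lambda>_. 0)" unfolding \<delta>(2)[symmetric] chain2[OF \<delta>(1)] by (rule bdry_zero)
      then have "\<gamma> {i} = 0" by (rule fun_cong)
      then show False by (simp add: \<gamma>_def)
    qed
  next
    assume na: "a \<notin> shift_exps M"
    show "acyclic_at TYPE('k) ?\<Delta> 1"
      unfolding acyclic_at_def
    proof (intro allI impI)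
      fix \<gamma> :: "'n set \<Rightarrow> 'k" assume \<gamma>: "chain_on ?\<Delta> 1 \<gamma> \<and> bdry \<gamma> = (\<lambda>_. 0)"
      have one: "\<gamma> {i} = 0 \<or> \<gamma> {j} = 0" if ij: "i \<noteq> j" for i j
      proof (rule ccontr)
        assume "\<not> ?thesis"
        then have "{i} \<in> ?\<Delta>" "{j} \<in> ?\<Delta>" using \<gamma> by (auto simp: chain_on_def)
        then obtain v w where vw: "v \<in> M" "a = v + \<epsilon> i" "w \<in> M" "a = w + \<epsilon> j"
          unfolding single by blast
        moreover have "v \<noteq> w" using vw ij by auto
        ultimately show False using na unfolding shift_exps_def by blast
      qed
      have zero: "\<gamma> {i} = 0" for i
      proof (rule ccontr)
        assume nz: "\<gamma> {i} \<noteq> 0"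
        have "(\<Sum>j\<in>UNIV. \<gamma> {j}) = (\<Sum>j\<in>{i}. \<gamma> {j})"
          using one nz by (intro sum.mono_neutral_right) auto
        moreover have "(\<Sum>j\<in>UNIV. \<gamma> {j}) = bdry \<gamma> {}" using \<gamma> bd[of \<gamma>] by simp
        moreover have "bdry \<gamma> {} = 0" using \<gamma> by simp
        ultimately show False using nz by simp
      qed
      have "\<gamma> A = 0" for A
      proof (cases "card A = 1")
        case True
        then show ?thesis using zero by (metis card_1_singletonE)
      qed (use \<gamma> in \<open>auto simp: chain_on_def\<close>)
      then have "\<gamma> = (\<lambda>_. 0)" by auto
      then show "\<exists>\<delta>. chain_on ?\<Delta> (Suc 1) \<delta> \<and> bdry \<delta> = \<gamma>"
        by (intro exI[of _ "\<lambda>_. 0"]) (simp add: chain_on_def)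
    qed
  qed
qed

text \<open>
  By linear quotients, \<open>Tor\<^sub>1\<close> lives in degree \<open>d + 1\<close> only.
\<close>

lemma HS_1_eq:
  fixes us :: "('n::{finite, linorder} \<Rightarrow>\<^sub>0 nat) list"
  assumes "lin_quot us" and deg: "\<And>u. u \<in> set us \<Longrightarrow> tdeg u = d"
  shows "HS 1 (ideal_gen (monom ` set us) :: ('n, 'k::field) pring set) =
    ideal_gen (monom ` shift_exps (set us))"
proof -
  have "Tor_multi_nonzero 1 (ideal_gen (monom ` set us) :: ('n, 'k) pring set) a \<longleftrightarrow>
      a \<in> shift_exps (set us)" for a
  proof (cases "tdeg a = Suc d")
    case True
    then show ?thesis
      unfolding Tor_multi_nonzero_iff by (simp add: acyclic_at_1_iff[OF deg True, simplified])
  next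
    case False
    then have "acyclic_at TYPE('k) (koszul_simplices (upset (set us)) a) 1"
      by (intro lin_quot_acyclic_at[OF assms]) auto
    moreover have "a \<notin> shift_exps (set us)" using False deg by (auto simp: shift_exps_def)
    ultimately show ?thesis unfolding Tor_multi_nonzero_iff by simp
  qed
  then have "{monom a | a. Tor_multi_nonzero 1 (ideal_gen (monom ` set us) :: ('n, 'k) pring set) a} =
      (monom ` shift_exps (set us) :: ('n, 'k) pring set)"
    by auto
  then show ?thesis by (simp only: HS_def)
qed

lemma HS_1_linear:
  fixes us :: "('n::{finite, linorder} \<Rightarrow>\<^sub>0 nat) list"
  assumes "lin_quot us" and deg: "\<And>u. u \<in> set us \<Longrightarrow> tdeg u = d"
    and I: "(I :: ('n, 'k::field) pring set) = ideal_gen (monom ` set us)"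
  shows "linear_quotients (HS 1 I) \<and> linear_resolution (HS 1 I)"
proof -
  obtain vs where vs: "lin_quot vs" "set vs = shift_exps (set us)" using lin_quot_shift_exps[OF assms(1)] by blast
  have "HS 1 I = ideal_gen (monom ` set vs)" unfolding I vs(2) by (rule HS_1_eq[OF assms(1,2)])
  moreover have "\<And>v. v \<in> set vs \<Longrightarrow> tdeg v = Suc d" unfolding vs(2) using deg by (auto simp: shift_exps_def)
  ultimately show ?thesis using lin_quot_imp_linear_quotients[OF vs(1)] lin_quot_imp_linear_resolution[OF vs(1)] by metis
qed

section \<open>Edge ideals with a linear resolution\<close>

lemma acyclic_at_Pow:
  fixes W :: "'n::{finite, linorder} set"
  assumes "p \<in> W"
  shows "acyclic_at TYPE('k::field) (Pow W) i"
  by (rule relative_cone[where \<Delta> = "{}" and p = p])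
     (use assms in \<open>auto simp: down_closed_def acyclic_at_empty\<close>)

text \<open>
  A chain on the facets \<open>W - {x}\<close> of the boundary of a simplex is a function of \<open>x\<close>; after
  multiplication with a suitable sign, its boundary on \<open>W - {x, z}\<close> becomes the difference of the values at
  \<open>x\<close> and \<open>z\<close>, up to sign. This is the coboundary of a function on the vertices.
\<close>

lemma bdry_remove_two:
  fixes \<zeta> :: "'n::{finite, linorder} set \<Rightarrow> 'k::field"
  assumes "x \<in> W" "z \<in> W" "x \<noteq> z" and \<zeta>: "\<And>A. \<zeta> A \<noteq> 0 \<Longrightarrow> A \<subseteq> W"
  shows "bdry \<zeta> (W - {x, z}) = 0 \<longleftrightarrow> ksign x W * \<zeta> (W - {x}) = ksign z W * \<zeta> (W - {z})"
proof -
  have *: "bdry \<zeta> (W - {x, z}) = 0 \<longleftrightarrow> ksign x W * \<zeta> (W - {x}) = ksign z W * \<zeta> (W - {z})"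
    if xz: "x \<in> W" "z \<in> W" "x < z" for x z
  proof -
    have ins: "insert x (W - {x, z}) = W - {z}" "insert z (W - {x, z}) = W - {x}" using xz by auto
    have "\<zeta> (insert j (W - {x, z})) = 0" if "j \<notin> W" for j using \<zeta> that by blast
    then have "bdry \<zeta> (W - {x, z}) = (\<Sum>j\<in>{x, z}. \<zeta> (insert j (W - {x, z})) * ksign j (insert j (W - {x, z})))"
      unfolding bdry_def using xz by (intro sum.mono_neutral_right) auto
    also have "\<dots> = \<zeta> (W - {z}) * ksign x (W - {z}) + \<zeta> (W - {x}) * ksign z (W - {x})"
      using xz(3) by (simp add: ins)
    also have "(ksign x (W - {z}) :: 'k) = ksign x W"
      unfolding ksign_def using xz(3) by (intro arg_cong[of _ _ "\<lambda>C. (-1) ^ card C"]) auto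
    also have "(ksign z (W - {x}) :: 'k) = - ksign z W"
      using ksign_insert(1)[of x z "W - {x}", where ?'k = 'k] xz by (simp add: insert_absorb)
    finally have "bdry \<zeta> (W - {x, z}) = ksign x W * \<zeta> (W - {z}) - ksign z W * \<zeta> (W - {x})"
      by (simp add: mult.commute)
    also have "\<dots> = ksign x W * ksign z W * (ksign z W * \<zeta> (W - {z}) - ksign x W * \<zeta> (W - {x}))"
      by (simp add: right_diff_distrib mult.assoc mult.left_commute[of "ksign z W" "ksign x W"])
    finally show ?thesis by auto
  qed
  show ?thesis
  proof (cases "x < z")
    case True
    then show ?thesis using * assms by blast
  next
    case False
    then have "z < x" using assms(3) by auto
    then have "bdry \<zeta> (W - {z, x}) = 0 \<longleftrightarrow> ksign z W * \<zeta> (W - {z}) = ksign x W * \<zeta> (W - {x})"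
      using * assms by blast
    then show ?thesis by (auto simp: insert_commute)
  qed
qed

definition edge_exps :: "'n set set \<Rightarrow> ('n \<Rightarrow>\<^sub>0 nat) set"
  where "edge_exps E = {\<epsilon> i + \<epsilon> j | i j. {i, j} \<in> E}"

lemma edge_ideal_eq:
  "(edge_ideal E :: ('n, 'k::field) pring set) = ideal_gen (monom ` edge_exps E)"
  unfolding edge_ideal_def edge_exps_def
  by (rule arg_cong[of _ _ ideal_gen]) (force simp: Var_eq_monom monom_mult)

text \<open>
  In the squarefree degree \<open>W\<close> the faces are the complements in \<open>W\<close> of vertex sets that are not independent in
  the graph: the complex is Alexander dual to the independence complex.
\<close>

lemma mem_koszul_simplices_edges:
  assumes "simple_graph E"
  shows "A \<in> koszul_simplices (upset (edge_exps E)) (set_exp W) \<longleftrightarrow>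
    A \<subseteq> W \<and> (\<exists>x y. {x, y} \<in> E \<and> x \<in> W - A \<and> y \<in> W - A)"
proof
  assume A: "A \<in> koszul_simplices (upset (edge_exps E)) (set_exp W)"
  then obtain b where b: "b \<in> upset (edge_exps E)" "set_exp W = b + set_exp A"
    by (auto simp: mem_koszul_simplices)
  then obtain x y where xy: "{x, y} \<in> E" "\<epsilon> x + \<epsilon> y \<preceq> b" by (auto simp: upset_def edge_exps_def)
  have eq: "(if j \<in> W then 1 else 0) = b\<langle>j\<rangle> + (if j \<in> A then 1 else 0)" for j
    using arg_cong[OF b(2), of "\<lambda>a. a\<langle>j\<rangle>"] by simp
  have "A \<subseteq> W"
  proof
    fix j assume "j \<in> A"
    then show "j \<in> W" using eq[of j] by (auto split: if_splits)
  qed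
  moreover have "(\<epsilon> x + \<epsilon> y)\<langle>x\<rangle> \<le> b\<langle>x\<rangle>" "(\<epsilon> x + \<epsilon> y)\<langle>y\<rangle> \<le> b\<langle>y\<rangle>"
    using xy(2) unfolding divides_exp_def by blast+
  then have "x \<in> W - A" "y \<in> W - A" using eq[of x] eq[of y] by (auto split: if_splits)
  ultimately show "A \<subseteq> W \<and> (\<exists>x y. {x, y} \<in> E \<and> x \<in> W - A \<and> y \<in> W - A)" using xy(1) by blast
next
  assume "A \<subseteq> W \<and> (\<exists>x y. {x, y} \<in> E \<and> x \<in> W - A \<and> y \<in> W - A)"
  then obtain x y where xy: "A \<subseteq> W" "{x, y} \<in> E" "x \<in> W - A" "y \<in> W - A" by blast
  then have "x \<noteq> y" using assms by (auto simp: simple_graph_def)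
  then have "\<epsilon> x + \<epsilon> y \<preceq> set_exp (W - A)" using xy by (auto simp: divides_exp_def)
  then have "set_exp (W - A) \<in> upset (edge_exps E)" using xy(2) by (auto simp: upset_def edge_exps_def)
  moreover have "set_exp W = set_exp (W - A) + set_exp A" using xy(1) by (auto simp: exp_eq_iff)
  ultimately show "A \<in> koszul_simplices (upset (edge_exps E)) (set_exp W)"
    unfolding mem_koszul_simplices by blast
qed

text \<open>
  Let \<open>uv\<close> be an edge of the complement \<open>H\<close> of the graph that lies in no triangle of \<open>H\<close> on \<open>W\<close>, but on a
  cycle of \<open>H\<close>; the latter is expressed by saying that a function which is constant along all
  other edges of \<open>H\<close> takes the same value at \<open>u\<close> and \<open>v\<close>. Then the independence complex on \<open>W\<close> has
  nonzero first cohomology: the cochain that is \<open>1\<close> on \<open>uv\<close> and \<open>0\<close> on the other edges is a cocycle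
  because \<open>uv\<close> lies in no triangle, and it is no coboundary because \<open>uv\<close> lies on a cycle.

  In the dual picture used here, pass to complements in \<open>W\<close>: the boundary of the face \<open>\<eta>\<close> complementary
  to \<open>uv\<close> is a cycle on \<open>\<Delta>\<close> because every triple containing \<open>u\<close> and \<open>v\<close> contains an edge of the graph.
  If it bounded a chain \<open>\<delta>\<close> on \<open>\<Delta>\<close>, then \<open>\<eta> - \<delta>\<close> would be a boundary in the full simplex, that
  is, a difference of values of a function \<open>y\<close> on the vertices. Since \<open>\<eta> - \<delta>\<close> vanishes on all edges of
  \<open>H\<close> other than \<open>uv\<close>, \<open>y u = y v\<close>, whereas the value on \<open>uv\<close> is \<open>1\<close>.
\<close>

lemma not_acyclic_at_of_complement_cycle:
  fixes E :: "'n::{finite, linorder} set set"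
  assumes simple: "simple_graph E"
    and uv: "u \<in> W" "v \<in> W" "u \<noteq> v" "{u, v} \<notin> E"
    and nb: "\<And>w. w \<in> W \<Longrightarrow> w \<noteq> u \<Longrightarrow> w \<noteq> v \<Longrightarrow> {u, w} \<in> E \<or> {v, w} \<in> E"
    and conn: "\<And>y :: 'n \<Rightarrow> 'k::field.
      (\<And>a b. a \<in> W \<Longrightarrow> b \<in> W \<Longrightarrow> a \<noteq> b \<Longrightarrow> {a, b} \<notin> E \<Longrightarrow> {a, b} \<noteq> {u, v} \<Longrightarrow> y a = y b) \<Longrightarrow> y u = y v"
    and card: "card W = i + 3"
  shows "\<not> acyclic_at TYPE('k) (koszul_simplices (upset (edge_exps E)) (set_exp W)) i"
proof
  let ?\<Delta> = "koszul_simplices (upset (edge_exps E)) (set_exp W)"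
  assume ac: "acyclic_at TYPE('k) ?\<Delta> i"
  note mem = mem_koszul_simplices_edges[OF simple]
  \<comment> \<open>The chain that is \<open>1\<close> on the complement of \<open>uv\<close>; its boundary lies on \<open>\<Delta>\<close>, it does not.\<close>
  define \<eta> :: "'n set \<Rightarrow> 'k" where "\<eta> A = (if A = W - {u, v} then 1 else 0)" for A
  have card2: "card (W - {u, v}) = Suc i" using uv card by (simp add: card_Diff_subset)
  have "chain_on ?\<Delta> i (bdry \<eta>)"
    unfolding chain_on_def
  proof (intro allI impI)
    fix A assume "bdry \<eta> A \<noteq> 0"
    then obtain j where j: "j \<notin> A" "\<eta> (insert j A) \<noteq> 0"
      unfolding bdry_def by (rule sum.not_neutral_contains_not_neutral) auto
    then have ins: "insert j A = W - {u, v}" by (auto simp: \<eta>_def split: if_splits)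
    then have jW: "j \<in> W" "j \<noteq> u" "j \<noteq> v" "A \<subseteq> W" "u \<notin> A" "v \<notin> A" by auto
    then have "A \<in> ?\<Delta>" unfolding mem using nb[OF jW(1-3)] uv j(1) by blast
    moreover have "card A = i" using card2 j(1) unfolding ins[symmetric] by simp
    ultimately show "A \<in> ?\<Delta> \<and> card A = i" ..
  qed
  then obtain \<delta> where \<delta>: "chain_on ?\<Delta> (Suc i) \<delta>" "bdry \<delta> = bdry \<eta>"
    using ac bdry_bdry[of \<eta>] unfolding acyclic_at_def by blast
  define \<kappa> where "\<kappa> A = \<eta> A - \<delta> A" for A
  have "chain_on (Pow W) (Suc i) \<kappa>"
    unfolding chain_on_def
  proof (intro allI impI)
    fix A assume "\<kappa> A \<noteq> 0"
    then have "\<eta> A \<noteq> 0 \<or> \<delta> A \<noteq> 0" by (auto simp: \<kappa>_def)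
    then show "A \<in> Pow W \<and> card A = Suc i"
    proof
      assume "\<delta> A \<noteq> 0"
      then have "A \<in> ?\<Delta>" "card A = Suc i" using \<delta>(1) unfolding chain_on_def by blast+
      then show ?thesis unfolding mem by blast
    qed (use card2 in \<open>auto simp: \<eta>_def split: if_splits\<close>)
  qed
  moreover have "bdry \<kappa> = (\<lambda>_. 0)" by (simp add: fun_eq_iff \<kappa>_def[abs_def] bdry_diff \<delta>(2))
  ultimately obtain \<zeta> where \<zeta>: "chain_on (Pow W) (Suc (Suc i)) \<zeta>" "bdry \<zeta> = \<kappa>"
    using acyclic_at_Pow[OF uv(1), where ?'k = 'k] unfolding acyclic_at_def by blast
  have \<zeta>W: "A \<subseteq> W" if "\<zeta> A \<noteq> 0" for A using \<zeta>(1) that unfolding chain_on_def by blast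
  have \<delta>0: "\<delta> (W - {a, b}) = 0" if "a \<in> W" "b \<in> W" "a \<noteq> b" "{a, b} \<notin> E" for a b
  proof (rule ccontr)
    assume "\<delta> (W - {a, b}) \<noteq> 0"
    then have "W - {a, b} \<in> ?\<Delta>" using \<delta>(1) unfolding chain_on_def by blast
    then obtain x y where xy: "{x, y} \<in> E" "x \<in> {a, b}" "y \<in> {a, b}" unfolding mem by auto
    then have "x \<noteq> y" using simple by (auto simp: simple_graph_def)
    then have "{x, y} = {a, b}" using xy by auto
    then show False using xy(1) that(4) by simp
  qed
  have "ksign u W * \<zeta> (W - {u}) = ksign v W * \<zeta> (W - {v})"
  proof (rule conn[of "\<lambda>x. ksign x W * \<zeta> (W - {x})"])
    fix a b assume ab: "a \<in> W" "b \<in> W" "a \<noteq> b" "{a, b} \<notin> E" "{a, b} \<noteq> {u, v}"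
    have "W - {a, b} \<noteq> W - {u, v}" using ab(1,2,5) uv by blast
    then have "\<kappa> (W - {a, b}) = 0" using \<delta>0[OF ab(1-4)] by (simp add: \<kappa>_def \<eta>_def)
    then have "bdry \<zeta> (W - {a, b}) = 0" by (simp add: \<zeta>(2))
    then show "ksign a W * \<zeta> (W - {a}) = ksign b W * \<zeta> (W - {b})"
      using bdry_remove_two[of a W b \<zeta>] ab(1-3) \<zeta>W by simp
  qed
  then have "bdry \<zeta> (W - {u, v}) = 0" using bdry_remove_two[of u W v \<zeta>] uv \<zeta>W by simp
  then have "\<kappa> (W - {u, v}) = 0" by (simp add: \<zeta>(2))
  then show False using \<delta>0[OF uv] by (simp add: \<kappa>_def \<eta>_def)
qed

text \<open>Adjacency in the complementary graph.\<close>

definition nonadj :: "'n set set \<Rightarrow> 'n \<Rightarrow> 'n \<Rightarrow> bool"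
  where "nonadj E a b \<longleftrightarrow> a \<noteq> b \<and> {a, b} \<notin> E"

lemma nonadj_sym: "nonadj E a b \<longleftrightarrow> nonadj E b a"
  by (auto simp: nonadj_def insert_commute)

text \<open>For \<open>b\<close> in \<open>X\<close>, the connected component of \<open>b\<close> in the subgraph of \<open>H\<close> induced on \<open>X\<close>.\<close>

definition reach :: "('a \<Rightarrow> 'a \<Rightarrow> bool) \<Rightarrow> 'a set \<Rightarrow> 'a \<Rightarrow> 'a set"
  where "reach H X b = {x. (b, x) \<in> {(x, y). x \<in> X \<and> y \<in> X \<and> H x y}\<^sup>*}"

lemma reach_self: "b \<in> reach H X b"
  by (simp add: reach_def)

lemma reach_step: "x \<in> reach H X b \<Longrightarrow> x \<in> X \<Longrightarrow> y \<in> X \<Longrightarrow> H x y \<Longrightarrow> y \<in> reach H X b"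
  unfolding reach_def by (auto intro: rtrancl_into_rtrancl)

lemma reach_induct [consumes 1, case_names self step]:
  assumes "x \<in> reach H X b" "P b"
    "\<And>x y. x \<in> reach H X b \<Longrightarrow> y \<in> reach H X b \<Longrightarrow> P x \<Longrightarrow> x \<in> X \<Longrightarrow> y \<in> X \<Longrightarrow> H x y \<Longrightarrow> P y"
  shows "P x"
proof -
  have "(b, x) \<in> {(x, y). x \<in> X \<and> y \<in> X \<and> H x y}\<^sup>*" using assms(1) by (simp add: reach_def)
  then show ?thesis
  proof (induction rule: rtrancl_induct)
    case base
    show ?case by (rule assms(2))
  next
    case (step y z)
    have "y \<in> reach H X b" using step(1) by (simp add: reach_def)
    moreover from this have "z \<in> reach H X b" using step(2) reach_step[of y H X b z] by simp
    ultimately show ?case using step assms(3)[of y z] by simp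
  qed
qed

lemma reach_subset: "b \<in> X \<Longrightarrow> reach H X b \<subseteq> X"
proof
  fix x assume "b \<in> X" and x: "x \<in> reach H X b"
  from x show "x \<in> X" by (induction rule: reach_induct) (simp_all add: \<open>b \<in> X\<close>)
qed

text \<open>
  The form in which chordality of the complement enters: if \<open>s\<close> and \<open>s'\<close> were not adjacent in the
  complement, then \<open>vs\<close> would lie in no triangle on \<open>{v, s, s'} \<union> B\<close>, although \<open>s\<close> is joined to \<open>v\<close>
  through \<open>B\<close> and \<open>s'\<close>.
\<close>

lemma neighbours_of_component_nonadj:
  fixes E :: "'n::{finite, linorder} set set"
  assumes simple: "simple_graph E"
    and lin: "\<And>i a. tdeg a \<noteq> i + 2 \<Longrightarrow> acyclic_at TYPE('k::field) (koszul_simplices (upset (edge_exps E)) a) i"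
    and B: "b \<in> X" "B = reach (nonadj E) X b" and v: "\<And>x. x \<in> X \<Longrightarrow> x \<noteq> v \<and> {v, x} \<in> E"
    and s: "nonadj E v s" "s \<notin> B" "x \<in> B" "nonadj E s x"
    and s': "nonadj E v s'" "s' \<notin> B" "x' \<in> B" "nonadj E s' x'"
    and "s \<noteq> s'"
  shows "nonadj E s s'"
proof (rule ccontr)
  assume "\<not> ?thesis"
  then have ss': "{s, s'} \<in> E" using \<open>s \<noteq> s'\<close> by (simp add: nonadj_def)
  let ?W = "insert v (insert s (insert s' B))"
  have BX: "B \<subseteq> X" unfolding B(2) using B(1) by (rule reach_subset)
  have vB: "v \<notin> B" using v BX by blast
  have vs: "v \<noteq> s" "v \<noteq> s'" using s(1) s'(1) by (simp_all add: nonadj_def)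
  have "finite B" by simp
  then have "card ?W = card B + 3" using vB s(2) s'(2) vs \<open>s \<noteq> s'\<close> by simp
  then have "card ?W = (card ?W - 3) + 3" by simp
  then have "\<not> acyclic_at TYPE('k) (koszul_simplices (upset (edge_exps E)) (set_exp ?W)) (card ?W - 3)"
  proof (rule not_acyclic_at_of_complement_cycle[OF simple, of v _ s, rotated -1])
    show "v \<in> ?W" "s \<in> ?W" "v \<noteq> s" "{v, s} \<notin> E" using s(1) by (auto simp: nonadj_def)
    fix w assume "w \<in> ?W" "w \<noteq> v" "w \<noteq> s"
    then have "w = s' \<or> w \<in> X" using BX by auto
    then show "{v, w} \<in> E \<or> {s, w} \<in> E" using v ss' by blast
  next
    fix y :: "'n \<Rightarrow> 'k"
    assume y: "\<And>a b. a \<in> ?W \<Longrightarrow> b \<in> ?W \<Longrightarrow> a \<noteq> b \<Longrightarrow> {a, b} \<notin> E \<Longrightarrow> {a, b} \<noteq> {v, s} \<Longrightarrow> y a = y b"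
    have yB: "y z = y b" if "z \<in> B" for z
      using that unfolding B(2)
    proof (induction rule: reach_induct)
      case (step z z')
      then have "z \<in> B" "z' \<in> B" by (simp_all add: B(2))
      then have "y z = y z'" using step.hyps vB by (intro y) (auto simp: nonadj_def)
      then show ?case using step by simp
    qed simp
    have "y s = y x" using s vB by (intro y) (auto simp: nonadj_def)
    moreover have "y s' = y x'" using s' vB by (intro y) (auto simp: nonadj_def)
    moreover have "y v = y s'" using s' vs \<open>s \<noteq> s'\<close> by (intro y) (auto simp: nonadj_def doubleton_eq_iff)
    ultimately show "y v = y s" using yB s(3) s'(3) by simp
  qed
  moreover have "tdeg (set_exp ?W) \<noteq> (card ?W - 3) + 2" using \<open>card ?W = card B + 3\<close> by simp
  ultimately show False using lin by blast
qed

text \<open>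
  Dirac's theorem: the complement has a simplicial vertex \<open>p\<close> in \<open>W\<close>; in terms of the graph itself, the
  neighbours of \<open>p\<close> cover all edges not containing \<open>p\<close>.

  Among all components \<open>B\<close>, in the complement, of the non-neighbours of some vertex \<open>v\<close> of \<open>W\<close>, choose
  one with the least number of elements, and let \<open>S\<close> be the set of neighbours of \<open>B\<close> outside \<open>B\<close>. All of \<open>S\<close> is adjacent to
  \<open>v\<close>, so \<open>S\<close> is a clique. If some \<open>s\<close> in \<open>S\<close> were not adjacent to some \<open>c\<close> in \<open>B\<close>, the component of \<open>c\<close>
  among the non-neighbours of \<open>s\<close> could not leave \<open>B\<close> through the clique \<open>S\<close>, and would be smaller.
  By the same argument \<open>B\<close> is a clique. Hence so is \<open>B \<union> S\<close>, and any vertex of \<open>B\<close> is simplicial.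
\<close>

lemma ex_covering_vertex:
  fixes E :: "'n::{finite, linorder} set set"
  assumes simple: "simple_graph E"
    and lin: "\<And>i a. tdeg a \<noteq> i + 2 \<Longrightarrow> acyclic_at TYPE('k::field) (koszul_simplices (upset (edge_exps E)) a) i"
    and "W \<noteq> {}"
  shows "\<exists>p\<in>W. \<forall>a\<in>W - {p}. \<forall>c\<in>W - {p}. {a, c} \<in> E \<longrightarrow> {p, a} \<in> E \<or> {p, c} \<in> E"
proof (cases "\<exists>v\<in>W. \<exists>b\<in>W. {v, b} \<in> E")
  case False
  then show ?thesis using \<open>W \<noteq> {}\<close> by blast
next
  case True
  let ?H = "nonadj E"
  define X where "X v = {x \<in> W. {v, x} \<in> E}" for v
  have Xne: "x \<noteq> v" if "x \<in> X v" for x v using that simple by (auto simp: X_def simple_graph_def)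
  define P where "P = (\<lambda>(v, b). v \<in> W \<and> b \<in> X v)"
  define f where "f = (\<lambda>(v, b). card (reach ?H (X v) b))"
  obtain vb where "P vb" using True by (auto simp: P_def X_def)
  from arg_min_nat_lemma[of P, OF this, of f]
  obtain v b where vb: "v \<in> W" "b \<in> X v"
    and minimal: "\<And>v' b'. v' \<in> W \<Longrightarrow> b' \<in> X v' \<Longrightarrow>
      card (reach ?H (X v) b) \<le> card (reach ?H (X v') b')"
    by (cases "arg_min f P") (auto simp: P_def f_def)
  define B where "B = reach ?H (X v) b"
  define S where "S = {s \<in> W - B. \<exists>x\<in>B. ?H s x}"
  have BX: "B \<subseteq> X v" unfolding B_def using vb(2) by (rule reach_subset)
  have BW: "B \<subseteq> W" using BX by (auto simp: X_def)
  have bB: "b \<in> B" by (simp add: B_def reach_self)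
  have S: "?H v s" if "s \<in> S" for s
  proof (rule ccontr)
    assume "\<not> ?H v s"
    from that obtain x where x: "s \<in> W" "s \<notin> B" "x \<in> B" "?H s x" by (auto simp: S_def)
    then have "x \<in> X v" using BX by blast
    show False
    proof (cases "s = v")
      case True
      then show ?thesis using \<open>x \<in> X v\<close> x(4) by (simp add: X_def nonadj_def)
    next
      case False
      then have "s \<in> X v" using \<open>\<not> ?H v s\<close> x(1) by (auto simp: X_def nonadj_def)
      then have "s \<in> B" using x(3,4) \<open>x \<in> X v\<close> nonadj_sym[of E s x] unfolding B_def
        using reach_step[of x ?H "X v" b s] by simp
      then show ?thesis using x(2) by simp
    qed
  qed
  have clique: "?H s s'" if ss: "s \<in> S" "s' \<in> S" "s \<noteq> s'" for s s'
  proof -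
    obtain x x' where "x \<in> B" "?H s x" "x' \<in> B" "?H s' x'" "s \<notin> B" "s' \<notin> B"
      using ss(1,2) by (auto simp: S_def)
    moreover have "x \<noteq> v \<and> {v, x} \<in> E" if "x \<in> X v" for x
      using that Xne[OF that] by (simp add: X_def)
    ultimately show ?thesis
      using neighbours_of_component_nonadj[OF simple lin vb(2) B_def, of v s x s' x']
        S[OF ss(1)] S[OF ss(2)] ss(3) by simp
  qed
  have SB: "?H s c" if sc: "s \<in> S" "c \<in> B" for s c
  proof (rule ccontr)
    assume nH: "\<not> ?H s c"
    have "s \<noteq> c" "s \<in> W" using sc by (auto simp: S_def)
    then have c: "c \<in> X s" using nH sc(2) BW by (auto simp: X_def nonadj_def)
    have "z \<in> B" if "z \<in> reach ?H (X s) c" for z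
      using that
    proof (induction rule: reach_induct)
      case (step z z')
      show ?case
      proof (rule ccontr)
        assume "z' \<notin> B"
        then have "z' \<in> S" using step nonadj_sym[of E z z'] by (auto simp: S_def X_def)
        then have "?H s z'" using clique[OF sc(1)] Xne[OF \<open>z' \<in> X s\<close>] by blast
        then show False using \<open>z' \<in> X s\<close> by (simp add: X_def nonadj_def)
      qed
    qed (use sc in simp)
    moreover obtain x where x: "x \<in> B" "?H s x" using sc(1) by (auto simp: S_def)
    moreover have "x \<notin> reach ?H (X s) c"
      using reach_subset[OF c, of ?H] x(2) by (auto simp: X_def nonadj_def)
    ultimately have "reach ?H (X s) c \<subset> B" by blast
    then have "card (reach ?H (X s) c) < card B" by (intro psubset_card_mono) auto
    then show False using minimal[OF \<open>s \<in> W\<close> c] by (simp add: B_def)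
  qed
  have BB: "?H c c'" if cc: "c \<in> B" "c' \<in> B" "c \<noteq> c'" for c c'
  proof (rule ccontr)
    assume nH: "\<not> ?H c c'"
    have c': "c' \<in> X c" using nH cc BW by (auto simp: X_def nonadj_def)
    have "z \<in> B" if "z \<in> reach ?H (X c) c'" for z
      using that
    proof (induction rule: reach_induct)
      case (step z z')
      show ?case
      proof (rule ccontr)
        assume "z' \<notin> B"
        then have "z' \<in> S" using step nonadj_sym[of E z z'] by (auto simp: S_def X_def)
        then have "?H z' c" using SB cc(1) by blast
        then show False using \<open>z' \<in> X c\<close> by (simp add: X_def nonadj_def insert_commute)
      qed
    qed (use cc in simp)
    moreover have "c \<notin> reach ?H (X c) c'" using reach_subset[OF c', of ?H] Xne by blast
    ultimately have "reach ?H (X c) c' \<subset> B" using cc(1) by blast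
    then have "card (reach ?H (X c) c') < card B" by (intro psubset_card_mono) auto
    then show False using minimal[of c c'] c' cc(1) BW by (auto simp: B_def)
  qed
  have near: "a \<in> B \<union> S" if "a \<in> W" "?H b a" for a
    using that bB nonadj_sym[of E b a] by (auto simp: S_def)
  have "{b, a} \<in> E \<or> {b, c} \<in> E" if ac: "a \<in> W - {b}" "c \<in> W - {b}" "{a, c} \<in> E" for a c
  proof (rule ccontr)
    assume "\<not> ?thesis"
    then have "a \<in> B \<union> S" "c \<in> B \<union> S" using ac near by (auto simp: nonadj_def)
    moreover have "a \<noteq> c" using ac(3) simple by (auto simp: simple_graph_def)
    ultimately have "?H a c" using BB SB clique nonadj_sym[of E a c] by blast
    then show False using ac(3) by (simp add: nonadj_def)
  qed
  then show ?thesis using bB BW by blast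
qed

text \<open>
  Edges at the covering vertex \<open>p\<close> come first. For any other edge \<open>ac\<close>, one of \<open>pa\<close>, \<open>pc\<close> is
  an edge, so \<open>x\<^sub>p\<close> lies in the colon ideal, and \<open>x\<^sub>p\<close> divides every edge at \<open>p\<close>.
\<close>

lemma ex_lin_quot_edges:
  fixes E :: "'n::{finite, linorder} set set"
  assumes simple: "simple_graph E"
    and lin: "\<And>i a. tdeg a \<noteq> i + 2 \<Longrightarrow> acyclic_at TYPE('k::field) (koszul_simplices (upset (edge_exps E)) a) i"
  shows "\<exists>gs. lin_quot gs \<and> set gs = {\<epsilon> a + \<epsilon> c | a c. a \<in> W \<and> c \<in> W \<and> {a, c} \<in> E}"
proof (induction "card W" arbitrary: W)
  case 0
  then have "W = {}" by simp
  then show ?case by (intro exI[of _ "[]"]) simp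
next
  case (Suc n)
  let ?edges = "\<lambda>W. {\<epsilon> a + \<epsilon> c | a c. a \<in> W \<and> c \<in> W \<and> {a, c} \<in> E}"
  have "W \<noteq> {}" using Suc.hyps(2) by auto
  from ex_covering_vertex[OF simple lin this] obtain p where p: "p \<in> W"
    "\<And>a c. a \<in> W - {p} \<Longrightarrow> c \<in> W - {p} \<Longrightarrow> {a, c} \<in> E \<Longrightarrow> {p, a} \<in> E \<or> {p, c} \<in> E"
    by blast
  have "n = card (W - {p})" using Suc.hyps(2) p(1) by simp
  from Suc.hyps(1)[OF this] obtain gs where gs: "lin_quot gs" "set gs = ?edges (W - {p})" by blast
  let ?N = "{\<epsilon> p + \<epsilon> a | a. a \<in> W \<and> {p, a} \<in> E}"
  have "?N \<subseteq> range (\<lambda>a. \<epsilon> p + \<epsilon> a)" by blast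
  moreover from finite_subset[OF this] have "finite ?N" by simp
  ultimately obtain xs where xs: "set xs = ?N" "lin_quot xs"
    using finite_distinct_list[of ?N] lin_quot_var_multiples[of _ "\<epsilon> p"] by auto
  have "lin_quot (xs @ gs)"
  proof (rule lin_quot_append[OF xs(2) gs(1)])
    have "g\<langle>p\<rangle> = 0" if "g \<in> set gs" for g using that by (auto simp: gs(2))
    moreover have "x\<langle>p\<rangle> > 0" if "x \<in> set xs" for x using that by (auto simp: xs(1))
    ultimately show "set xs \<inter> set gs = {}" by fastforce
    fix u assume "u \<in> set gs"
    then obtain a c where ac: "u = \<epsilon> a + \<epsilon> c" "a \<in> W - {p}" "c \<in> W - {p}" "{a, c} \<in> E"
      by (auto simp: gs(2))
    from p(2)[OF ac(2-4)] obtain a' c' where a': "u = \<epsilon> a' + \<epsilon> c'" "a' \<in> W" "{p, a'} \<in> E"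
      using ac by (metis DiffD1 add.commute)
    have "\<epsilon> p + \<epsilon> a' \<in> set xs" using a' by (auto simp: xs(1))
    moreover have "(\<epsilon> p + \<epsilon> a') + \<epsilon> c' = u + \<epsilon> p" by (simp add: a'(1) add_ac)
    moreover have "u\<langle>p\<rangle> < v\<langle>p\<rangle>" if "v \<in> set xs" for v using that ac by (auto simp: xs(1))
    ultimately show "linear_step (set xs) u" unfolding linear_step_def by blast
  qed
  moreover have "set (xs @ gs) = ?edges W"
  proof (intro equalityI subsetI)
    fix x assume "x \<in> ?edges W"
    then obtain a c where ac: "x = \<epsilon> a + \<epsilon> c" "a \<in> W" "c \<in> W" "{a, c} \<in> E" by blast
    show "x \<in> set (xs @ gs)"
    proof (cases "a = p \<or> c = p")
      case True
      then have "x \<in> ?N"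
      proof
        assume "c = p"
        then have "x = \<epsilon> p + \<epsilon> a" "{p, a} \<in> E" using ac by (simp_all add: add.commute insert_commute)
        then show ?thesis using ac(2) by blast
      qed (use ac in blast)
      then show ?thesis by (simp add: xs(1))
    next
      case False
      then have "x \<in> ?edges (W - {p})" using ac by blast
      then show ?thesis by (simp add: gs(2))
    qed
  next
    fix x assume "x \<in> set (xs @ gs)"
    then have "x \<in> ?N \<or> x \<in> ?edges (W - {p})" by (simp add: xs(1) gs(2))
    then show "x \<in> ?edges W" using p(1) by blast
  qed
  ultimately show ?case by blast
qed

text \<open>
  The degree in which the linear resolution is generated is not part of the hypothesis; it is \<open>2\<close>
  because \<open>Tor\<^sub>0\<close> is nonzero in the degree of any edge.
\<close>

lemma edge_ideal_linear_acyclic: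
  fixes E :: "'n::{finite, linorder} set set"
  assumes "linear_resolution (edge_ideal E :: ('n, 'k::field) pring set)" "simple_graph E" "tdeg a \<noteq> i + 2"
  shows "acyclic_at TYPE('k) (koszul_simplices (upset (edge_exps E)) a) i"
proof (cases "E = {}")
  case True
  then have "koszul_simplices (upset (edge_exps E)) a = {}"
    by (simp add: koszul_simplices_def upset_def edge_exps_def)
  then show ?thesis by (simp only: acyclic_at_empty)
next
  case False
  then obtain x y where xy: "{x, y} \<in> E"
    using assms(2) by (metis all_not_in_conv card_2_iff simple_graph_def)
  let ?I = "ideal_gen (monom ` edge_exps E) :: ('n, 'k) pring set"
  let ?a = "\<epsilon> x + \<epsilon> y"
  have a: "?a \<in> edge_exps E" using xy by (auto simp: edge_exps_def)
  have "monom ?a \<in> ?I" using a subset_upset by (auto simp: monom_mem_ideal_gen_iff)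
  moreover have "(monom ?a :: ('n, 'k) pring) \<noteq> 0" by (metis keys_single keys_zero monom_def insert_not_empty zero_neq_one)
  ultimately have "?I \<noteq> {0}" by blast
  then obtain d where d: "\<And>i m. m \<noteq> i + d \<Longrightarrow> \<not> Tor_nonzero i ?I m"
    using assms(1) unfolding linear_resolution_def edge_ideal_eq by blast
  have deg: "tdeg u = 2" if "u \<in> edge_exps E" for u using that by (auto simp: edge_exps_def)
  have "d = 2"
  proof (rule ccontr)
    assume "d \<noteq> 2"
    then have ac: "acyclic_at TYPE('k) (koszul_simplices (upset (edge_exps E)) ?a) 0"
      using d[of 2 0] unfolding Tor_nonzero_iff by auto
    define \<gamma> :: "'n set \<Rightarrow> 'k" where "\<gamma> A = (if A = {} then 1 else 0)" for A
    have "{} \<in> koszul_simplices (upset (edge_exps E)) ?a"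
      using a subset_upset by (force simp: mem_koszul_simplices set_exp_def)
    then have "chain_on (koszul_simplices (upset (edge_exps E)) ?a) 0 \<gamma>"
      by (simp add: chain_on_def \<gamma>_def)
    moreover have "bdry \<gamma> = (\<lambda>_. 0)" by (simp add: bdry_def \<gamma>_def fun_eq_iff)
    ultimately obtain \<delta> where \<delta>: "chain_on (koszul_simplices (upset (edge_exps E)) ?a) (Suc 0) \<delta>" "bdry \<delta> = \<gamma>"
      using ac unfolding acyclic_at_def by blast
    have "\<delta> A = 0" for A
    proof (rule ccontr)
      assume "\<delta> A \<noteq> 0"
      then have "A \<in> koszul_simplices (upset (edge_exps E)) ?a" "card A = 1"
        using \<delta>(1) by (auto simp: chain_on_def)
      then obtain b where b: "b \<in> upset (edge_exps E)" "?a = b + set_exp A" by (auto simp: mem_koszul_simplices)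
      from arg_cong[OF b(2), of tdeg] have "tdeg b = 1" using \<open>card A = 1\<close> by simp
      then show False using upset_tdeg(1)[OF deg b(1)] by simp
    qed
    then have "bdry \<delta> = (\<lambda>_. 0)" by (simp add: bdry_def fun_eq_iff)
    then have "\<gamma> {} = 0" using \<delta>(2) by simp
    then show False by (simp add: \<gamma>_def)
  qed
  then show ?thesis using d[of "tdeg a" i] assms(3) unfolding Tor_nonzero_iff by blast
qed

theorem theorem4p2:
  fixes E :: "'n::{finite, linorder} set set"
    and I :: "('n, 'k::field) pring set"
  assumes "simple_graph E"
    and "I = edge_ideal E"
    and "linear_resolution I"
  shows "\<forall>k::nat. k \<ge> 1 \<longrightarrow> linear_quotients (HS 1 (ideal_power I k)) \<and>
                linear_resolution (HS 1 (ideal_power I k))"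
proof (intro allI impI)
  fix k :: nat
  have lin: "acyclic_at TYPE('k) (koszul_simplices (upset (edge_exps E)) a) i" if "tdeg a \<noteq> i + 2" for a i
    using edge_ideal_linear_acyclic[OF _ assms(1) that] assms(2,3) by blast
  obtain gs where gs: "lin_quot gs" "set gs = edge_exps E"
    using ex_lin_quot_edges[OF assms(1) lin, of UNIV] by (auto simp: edge_exps_def)
  have deg: "tdeg g = 2" if "g \<in> set gs" for g using that by (auto simp: gs(2) edge_exps_def)
  obtain us where us: "lin_quot us" "set us = power_exps gs k" using lin_quot_power_exps[OF gs(1) deg] by blast
  have "I = ideal_gen (monom ` set gs)" unfolding gs(2) assms(2) by (rule edge_ideal_eq)
  then have pow: "ideal_power I k = ideal_gen (monom ` set us)" unfolding us(2) by (rule ideal_power_eq)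
  have "tdeg u = 2 * k" if "u \<in> set us" for u
    using that tdeg_prod_exp[of gs 2, OF deg] by (auto simp: us(2) power_exps_def)
  then show "linear_quotients (HS 1 (ideal_power I k)) \<and> linear_resolution (HS 1 (ideal_power I k))"
    using HS_1_linear[OF us(1) _ pow] by blast
qed

end
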